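(* Let $f=h+\overline{g}\in\mathcal{AK}^0_H$ with $h(z)=z+\sum_{n\ge2}a_nz^n$. Then $|a_2|\le 2/\sqrt{3}$. Moreover, every $f\in\mathcal{AK}^0_H$ satisfies $$\left(\frac{\sqrt{3}}{\sqrt{3}+4}\right)\left[1-\left(\frac{1-r}{1+r}\right)^{\frac{\sqrt{3}+4}{2\sqrt{3}}}\right]\le|f(z)|\le\left(\frac{\sqrt{3}}{\sqrt{3}+4}\right)\left[\left(\frac{1+r}{1-r}\right)^{\frac{\sqrt{3}+4}{2\sqrt{3}}}-1\right]$$ for $0<|z|=r<1$. In particular, the range $f(\mathbb{D})$ of each $f\in\mathcal{AK}^0_H$ contains the disk $\{w:|w|<\sqrt{3}/(\sqrt{3}+4)\}$.
   Context: $\mathbb{D}=\{z\in\mathbb{C}:|z|<1\}$. $\mathcal{H}$ is the class of complex-valued harmonic functions $f=h+\overline{g}$ in $\mathbb{D}$, with $h,g$ analytic in $\mathbb{D}$ and $h(z)=z+\sum_{n\ge2}a_nz^n$, $g(z)=\sum_{n\ge1}b_nz^n$. For $a\in\mathbb{D}$, $r>0$, let $\mathbb{D}(a,r)=\{z\in\mathbb{D}:|z-a|<r\}$. $\mathcal{AK}_H$ (absolutely convex harmonic mappings) is the class of locally univalent $f\in\mathcal{H}$ such that $f(\mathbb{D}(a,r))$ is convex for all $a\in\mathbb{D}$ and all $r\in(0,1-|a|)$, and $\mathcal{AK}^0_H=\{f=h+\overline{g}\in\mathcal{AK}_H: g'(0)=0\}$. *)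

theory Defs
  imports "HOL-Complex_Analysis.Complex_Analysis"
begin

abbreviation unit_disc :: "complex set" where
  "unit_disc \<equiv> ball 0 1"

(* f = h + cnj g on the disc, with h z = z + a 2 * z^2 + a 3 * z^3 + ... and
   g z = b 1 * z + b 2 * z^2 + ...  (a 0, a 1 and b 0 play no role).
   Functions are total; only their values on the unit disc matter. *)
definition harmonic_repr ::
  "(complex \<Rightarrow> complex) \<Rightarrow> (complex \<Rightarrow> complex) \<Rightarrow> (complex \<Rightarrow> complex)
    \<Rightarrow> (nat \<Rightarrow> complex) \<Rightarrow> (nat \<Rightarrow> complex) \<Rightarrow> bool" where
  "harmonic_repr f h g a b \<longleftrightarrow>
     h analytic_on unit_disc \<and> g analytic_on unit_disc \<and>
     (\<forall>z\<in>unit_disc. f z = h z + cnj (g z)) \<and>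
     (\<forall>z\<in>unit_disc. (\<lambda>n. a (n + 2) * z ^ (n + 2)) sums (h z - z)) \<and>
     (\<forall>z\<in>unit_disc. (\<lambda>n. b (n + 1) * z ^ (n + 1)) sums g z)"

(* Harmonicity of f is implied by the decomposition. *)
definition class_H :: "(complex \<Rightarrow> complex) set" where
  "class_H = {f. \<exists>h g a b. harmonic_repr f h g a b}"

definition locally_univalent :: "(complex \<Rightarrow> complex) \<Rightarrow> bool" where
  "locally_univalent f \<longleftrightarrow>
     (\<forall>z\<in>unit_disc. \<exists>U. open U \<and> z \<in> U \<and> U \<subseteq> unit_disc \<and> inj_on f U)"

definition sub_disc :: "complex \<Rightarrow> real \<Rightarrow> complex set" where
  "sub_disc c r = {z \<in> unit_disc. norm (z - c) < r}"

definition class_AK :: "(complex \<Rightarrow> complex) set" where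
  "class_AK = {f \<in> class_H. locally_univalent f \<and>
     (\<forall>c\<in>unit_disc. \<forall>r. 0 < r \<and> r < 1 - norm c \<longrightarrow> convex (f ` sub_disc c r))}"

(* The decomposition of f is unique on the disc, so the existential only names g. *)
definition class_AK0 :: "(complex \<Rightarrow> complex) set" where
  "class_AK0 = {f \<in> class_AK. \<exists>h g a b. harmonic_repr f h g a b \<and> deriv g 0 = 0}"

end

theory Submission
  imports Defs
begin

text \<open>
The estimates rest on the convexity of the images of all discs inside the unit disc, not only of the
concentric ones. Write \<open>f = h + cnj g\<close> and let \<open>J = \<bar>h'\<bar>\<^sup>2 - \<bar>g'\<bar>\<^sup>2\<close> be the Jacobian. If a disc of
radius \<open>\<rho>\<close> has \<open>z\<close> on its boundary with outer normal \<open>e\<close>, then the curvature of the image of its boundary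
at \<open>f z\<close> is non-negative exactly when
\<open>J + \<rho> * Re (e * P + e ^ 3 * Q) \<ge> 0\<close>, where \<open>P = cnj h' * h'' - cnj g' * g''\<close> and \<open>Q = h' * g'' - g' * h''\<close>.
For the largest such disc inside the unit disc this becomes
\<open>2 * J + Re (e * ((1 - \<bar>z\<bar>\<^sup>2) * P - 2 * cnj z * J) + e ^ 3 * (1 - \<bar>z\<bar>\<^sup>2) * Q) \<ge> 0\<close>
for all unimodular \<open>e\<close> (\<open>curvature_inequality\<close>). Adding the inequalities for two directions that enclose an
angle of 60 degrees removes the cubic term and gives
\<open>\<bar>(1 - \<bar>z\<bar>\<^sup>2) * P - 2 * cnj z * J\<bar> \<le> 4 / sqrt 3 * J\<close> (\<open>second_order_bound\<close>). At \<open>z = 0\<close> this is the bound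
for the second coefficient.

At the other points, the Schwarz-Pick inequality for the dilatation \<open>g' / h'\<close> bounds \<open>Q\<close>
(\<open>wronskian_bound\<close>), and the two estimates together yield, for \<open>H = h + \<epsilon> * g\<close> with unimodular \<open>\<epsilon>\<close>,
\<open>\<bar>(1 - \<bar>z\<bar>\<^sup>2) * H'' - 2 * cnj z * H'\<bar> \<le> 2 * \<alpha> * \<bar>H'\<bar>\<close> with \<open>\<alpha> = 2 / sqrt 3 + 1 / 2\<close>
(\<open>pre_schwarzian_bound\<close>). This is the classical differential inequality of a linearly invariant family of
order \<open>\<alpha>\<close>. Integrated along radii it controls \<open>\<bar>H'\<bar>\<close>, hence \<open>\<bar>h'\<bar> + \<bar>g'\<bar>\<close> and \<open>\<bar>h'\<bar> - \<bar>g'\<bar>\<close>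
(\<open>differential_distortion\<close>). A second integration, along the radius for the upper bound and along the
preimage of a segment for the lower one, gives the growth estimates; the covered disc has the limit of the
lower bound as its radius.

The curvature inequality needs a support line at \<open>f z\<close>, and \<open>f z\<close> must not be covered by another
part of the disc. So two facts have to be established beforehand: the Jacobian is positive
(\<open>jacobian_pos\<close>, from Lewy's theorem), and \<open>f\<close> is injective on the whole disc (\<open>inj_f\<close>).
\<close>

section \<open>Level arcs at a critical point\<close>

text \<open>The Taylor expansion at a critical point \<open>\<xi>\<close> starts with a power \<open>m \<ge> 2\<close>, and an \<open>m\<close>-th root of
\<open>\<Phi> - \<Phi> \<xi>\<close> has non-zero derivative there, so its local inverse \<open>\<kappa>\<close> is a coordinate in which \<open>\<Phi>\<close>
becomes a pure power. The factor \<open>c\<close>, which is 0 or 1, lets the same formula cover a locally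
constant \<open>\<Phi>\<close>.\<close>

lemma critical_point_power_coordinate:
  fixes \<Phi> :: "complex \<Rightarrow> complex"
  assumes hol: "\<Phi> holomorphic_on S" and S: "open S" "\<xi> \<in> S"
    and crit: "deriv \<Phi> \<xi> = 0"
  obtains \<kappa> \<epsilon> c m where "0 < \<epsilon>" "continuous_on (cball 0 \<epsilon>) \<kappa>" "inj_on \<kappa> (cball 0 \<epsilon>)"
    "\<kappa> ` cball 0 \<epsilon> \<subseteq> S" "\<kappa> 0 = \<xi>" "2 \<le> m"
    "\<And>y. y \<in> cball 0 \<epsilon> \<Longrightarrow> \<Phi> (\<kappa> y) = \<Phi> \<xi> + complex_of_real c * y ^ m"
proof -
  obtain r where r: "0 < r" "ball \<xi> r \<subseteq> S"
    using S by (blast elim!: openE)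
  have hol': "\<Phi> holomorphic_on ball \<xi> r"
    using hol r(2) by (rule holomorphic_on_subset)
  show ?thesis
  proof (cases "\<forall>n>0. (deriv ^^ n) \<Phi> \<xi> = 0")
    case True
    have const: "\<Phi> w = \<Phi> \<xi>" if "w \<in> ball \<xi> r" for w
      by (meson open_ball True r(1) centre_in_ball connected_ball hol'
                holomorphic_fun_eq_const_on_connected that)
    show ?thesis
    proof (rule that[of "r/2" "\<lambda>y. \<xi> + y" 2 0])
      have sub: "(+) \<xi> ` cball 0 (r/2) \<subseteq> ball \<xi> r"
        using r(1) by (auto simp: dist_norm)
      show "(+) \<xi> ` cball 0 (r/2) \<subseteq> S" using sub r(2) by blast
      show "\<Phi> (\<xi> + y) = \<Phi> \<xi> + complex_of_real 0 * y ^ 2" if "y \<in> cball 0 (r/2)" for y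
        using const[of "\<xi> + y"] r(1) that by (simp add: dist_norm)
    qed (use r(1) in \<open>auto intro: continuous_intros\<close>)
  next
    case False
    define n where [abs_def]: "n = (LEAST n. n > 0 \<and> (deriv ^^ n) \<Phi> \<xi> \<noteq> 0)"
    have n_ne: "n > 0" "(deriv ^^ n) \<Phi> \<xi> \<noteq> 0"
      using False def_LeastI[OF n_def] by blast+
    have n_min: "\<And>k. 0 < k \<Longrightarrow> k < n \<Longrightarrow> (deriv ^^ k) \<Phi> \<xi> = 0"
      using def_Least_le[OF n_def] not_le by auto
    have "n \<noteq> 1" using n_ne(2) crit by auto
    then have n2: "2 \<le> n" using n_ne(1) by linarith
    obtain g \<delta> where "0 < \<delta>" and holg: "g holomorphic_on ball \<xi> \<delta>"
      and fd: "\<And>w. w \<in> ball \<xi> \<delta> \<Longrightarrow> \<Phi> w - \<Phi> \<xi> = ((w - \<xi>) * g w) ^ n"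
      and gnz: "\<And>w. w \<in> ball \<xi> \<delta> \<Longrightarrow> g w \<noteq> 0"
      by (blast intro: n_min holomorphic_factor_order_of_zero_strong[OF hol S n_ne])
    define d where "d = min r \<delta>"
    have d: "0 < d" "ball \<xi> d \<subseteq> S" "ball \<xi> d \<subseteq> ball \<xi> \<delta>"
      using r \<open>0 < \<delta>\<close> by (auto simp: d_def)
    define \<psi> where "\<psi> = (\<lambda>w. (w - \<xi>) * g w)"
    have hol\<psi>: "\<psi> holomorphic_on ball \<xi> d"
      unfolding \<psi>_def using holg d(3) by (auto intro!: holomorphic_intros elim: holomorphic_on_subset)
    have "(g has_field_derivative deriv g \<xi>) (at \<xi>)"
      using holg \<open>0 < \<delta>\<close> by (simp add: holomorphic_derivI)
    then have "(\<psi> has_field_derivative g \<xi>) (at \<xi>)"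
      unfolding \<psi>_def by (auto intro!: derivative_eq_intros)
    then have "deriv \<psi> \<xi> \<noteq> 0"
      using gnz[of \<xi>] \<open>0 < \<delta>\<close> by (simp add: DERIV_imp_deriv)
    then obtain \<rho> where \<rho>: "0 < \<rho>" "ball \<xi> \<rho> \<subseteq> ball \<xi> d" "open (\<psi> ` ball \<xi> \<rho>)" "inj_on \<psi> (ball \<xi> \<rho>)"
      using has_complex_derivative_locally_invertible[OF hol\<psi>, of \<xi>] d(1) by auto
    have "\<psi> holomorphic_on ball \<xi> \<rho>" using hol\<psi> \<rho>(2) holomorphic_on_subset by blast
    then obtain \<kappa> where \<kappa>: "\<kappa> holomorphic_on (\<psi> ` ball \<xi> \<rho>)" "\<And>z. z \<in> ball \<xi> \<rho> \<Longrightarrow> \<kappa> (\<psi> z) = z"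
      using holomorphic_has_inverse[of \<psi> "ball \<xi> \<rho>"] \<rho>(4) by (metis open_ball)
    have "0 \<in> \<psi> ` ball \<xi> \<rho>" using \<rho>(1) by (auto simp: \<psi>_def intro!: image_eqI[of _ _ \<xi>])
    then obtain \<epsilon> where \<epsilon>: "0 < \<epsilon>" "cball 0 \<epsilon> \<subseteq> \<psi> ` ball \<xi> \<rho>"
      using \<rho>(3) open_contains_cball by blast
    have in_ball: "\<kappa> y \<in> ball \<xi> \<rho>" and right_inv: "\<psi> (\<kappa> y) = y" if "y \<in> cball 0 \<epsilon>" for y
      using that \<epsilon>(2) \<kappa>(2) by auto
    show ?thesis
    proof (rule that[of \<epsilon> \<kappa> n 1])
      show "continuous_on (cball 0 \<epsilon>) \<kappa>"
        using \<kappa>(1) \<epsilon>(2) continuous_on_subset holomorphic_on_imp_continuous_on by blast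
      show "inj_on \<kappa> (cball 0 \<epsilon>)"
        by (metis inj_onI right_inv)
      show "\<kappa> ` cball 0 \<epsilon> \<subseteq> S" using in_ball \<rho>(2) d(2) by blast
      show "\<kappa> 0 = \<xi>" using \<kappa>(2)[of \<xi>] \<rho>(1) by (simp add: \<psi>_def)
      show "\<Phi> (\<kappa> y) = \<Phi> \<xi> + complex_of_real 1 * y ^ n" if y: "y \<in> cball 0 \<epsilon>" for y
      proof -
        have "\<kappa> y \<in> ball \<xi> \<delta>" using in_ball[OF y] \<rho>(2) d(3) by blast
        from fd[OF this] right_inv[OF y] show ?thesis by (simp add: \<psi>_def algebra_simps)
      qed
    qed (use \<epsilon> n2 in auto)
  qed
qed

text \<open>Two of the three non-zero numbers \<open>q k 1\<close> have the same sign, and by the intermediate value theorem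
both of these functions take the one of the two values that is closer to 0.\<close>

lemma three_arcs_not_injective:
  fixes q :: "nat \<Rightarrow> real \<Rightarrow> real"
  assumes cont: "\<And>k. k < 3 \<Longrightarrow> continuous_on {0..1} (q k)"
    and zero: "\<And>k. k < 3 \<Longrightarrow> q k 0 = 0"
    and nz: "\<And>k t. k < 3 \<Longrightarrow> 0 < t \<Longrightarrow> t \<le> 1 \<Longrightarrow> q k t \<noteq> 0"
  obtains j k s t where "j < 3" "k < 3" "j \<noteq> k" "0 < s" "s \<le> 1" "0 < t" "t \<le> 1" "q j s = q k t"
proof -
  note conclude = that
  have same_side: ?thesis
    if jk: "j < 3" "k < 3" "j \<noteq> k" and same: "0 < q j 1 \<and> 0 < q k 1 \<or> q j 1 < 0 \<and> q k 1 < 0" for j k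
  proof -
    obtain v where v: "v \<noteq> 0" and vj: "0 \<le> v \<and> v \<le> q j 1 \<or> q j 1 \<le> v \<and> v \<le> 0"
      and vk: "0 \<le> v \<and> v \<le> q k 1 \<or> q k 1 \<le> v \<and> v \<le> 0"
    proof (cases "0 < q j 1")
      case True
      then show ?thesis using same
        by (intro that(1)[of "min (q j 1) (q k 1)"]) auto
    next
      case False
      then show ?thesis using same
        by (intro that(1)[of "max (q j 1) (q k 1)"]) auto
    qed
    have hit: "\<exists>s. 0 < s \<and> s \<le> 1 \<and> q i s = v"
      if "i < 3" "0 \<le> v \<and> v \<le> q i 1 \<or> q i 1 \<le> v \<and> v \<le> 0" for i
    proof -
      have "\<exists>s\<ge>0. s \<le> 1 \<and> q i s = v"
        using that(2) IVT'[of "q i" 0 v 1] IVT2'[of "q i" 1 v 0] cont[OF that(1)] zero[OF that(1)] by auto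
      then show ?thesis using v zero[OF that(1)] by (metis order_le_less)
    qed
    show ?thesis
      using hit[OF jk(1) vj] hit[OF jk(2) vk] jk conclude by metis
  qed
  have "q 0 1 \<noteq> 0" "q 1 1 \<noteq> 0" "q 2 1 \<noteq> 0" using nz by auto
  then consider "0 < q 0 1 \<and> 0 < q 1 1 \<or> q 0 1 < 0 \<and> q 1 1 < 0"
    | "0 < q 0 1 \<and> 0 < q 2 1 \<or> q 0 1 < 0 \<and> q 2 1 < 0"
    | "0 < q 1 1 \<and> 0 < q 2 1 \<or> q 1 1 < 0 \<and> q 2 1 < 0" by linarith
  then show ?thesis
    using same_side[of 0 1] same_side[of 0 2] same_side[of 1 2] by cases auto
qed

text \<open>In the power coordinate, the rays on which the \<open>m\<close>-th power is purely imaginary lie on the level set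
of \<open>Re \<Phi>\<close> through \<open>\<xi>\<close>, and there are \<open>2 * m \<ge> 4\<close> of them. A map that is injective and continuous near
\<open>\<xi>\<close> with first coordinate \<open>Re \<Phi>\<close> would embed three such arcs with a common end point into a
line.\<close>

lemma critical_point_not_injective:
  fixes \<Phi> :: "complex \<Rightarrow> complex" and v :: "complex \<Rightarrow> real"
  assumes hol: "\<Phi> holomorphic_on S" and S: "open S" "\<xi> \<in> S"
    and crit: "deriv \<Phi> \<xi> = 0" and cont: "continuous_on S v"
  shows "\<not> inj_on (\<lambda>z. (Re (\<Phi> z), v z)) S"
proof
  assume inj: "inj_on (\<lambda>z. (Re (\<Phi> z), v z)) S"
  obtain \<kappa> \<epsilon> c m where \<epsilon>: "0 < \<epsilon>" and cont\<kappa>: "continuous_on (cball 0 \<epsilon>) \<kappa>"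
    and inj\<kappa>: "inj_on \<kappa> (cball 0 \<epsilon>)" and sub: "\<kappa> ` cball 0 \<epsilon> \<subseteq> S" and \<kappa>0: "\<kappa> 0 = \<xi>" and m: "2 \<le> m"
    and power: "\<And>y. y \<in> cball 0 \<epsilon> \<Longrightarrow> \<Phi> (\<kappa> y) = \<Phi> \<xi> + complex_of_real c * y ^ m"
    using critical_point_power_coordinate[OF hol S crit] by metis
  \<comment> \<open>Three consecutive odd multiples of \<open>pi / (2 * m)\<close>, starting at \<open>- pi / (2 * m)\<close> so that all of them
    lie in the range where \<open>cis\<close> is injective.\<close>
  define \<theta> where "\<theta> = (\<lambda>k::nat. (2 * real k - 1) * pi / (2 * real m))"
  define \<gamma> where "\<gamma> = (\<lambda>k t. \<kappa> (complex_of_real (\<epsilon> * t) * cis (\<theta> k)))"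
  have in_disc: "complex_of_real (\<epsilon> * t) * cis (\<theta> k) \<in> cball 0 \<epsilon>" if "0 \<le> t" "t \<le> 1" for k t
    using that \<epsilon> by (simp add: norm_mult mult_left_le)
  have \<gamma>_S: "\<gamma> k t \<in> S" if "0 \<le> t" "t \<le> 1" for k t
    using in_disc[OF that] sub unfolding \<gamma>_def by blast
  have level: "Re (\<Phi> (\<gamma> k t)) = Re (\<Phi> \<xi>)" if "0 \<le> t" "t \<le> 1" for k t
  proof -
    have "real m * \<theta> k = of_int (2 * int k - 1) * (pi / 2)"
      using m by (simp add: \<theta>_def field_simps)
    moreover have "cos (of_int (2 * int k - 1) * (pi / 2)) = 0"
      by (subst cos_zero_iff_int) (auto intro!: exI[of _ "2 * int k - 1"])
    ultimately have "Re (cis (\<theta> k) ^ m) = 0"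
      by (simp only: flip: cos_n_Re_cis_pow_n)
    then show ?thesis
      using power[OF in_disc[OF that, of k]]
      by (simp add: \<gamma>_def power_mult_distrib flip: of_real_power of_real_mult)
  qed
  have angle: "j = k" if "cis (\<theta> j) = cis (\<theta> k)" "j < 3" "k < 3" for j k
  proof -
    have range: "- pi < \<theta> i \<and> \<theta> i \<le> pi" if "i < 3" for i
    proof -
      have "\<bar>2 * real i - 1\<bar> < 2 * real m"
        using that m by auto
      then have "\<bar>2 * real i - 1\<bar> / (2 * real m) * pi < 1 * pi"
        using m by (intro mult_strict_right_mono) auto
      then have "\<bar>\<theta> i\<bar> < pi"
        by (simp add: \<theta>_def abs_mult)
      then show ?thesis by linarith
    qed
    have "\<theta> j = \<theta> k" by (metis Arg_cis greaterThanAtMost_iff range that)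
    then show ?thesis using m by (simp add: \<theta>_def)
  qed
  have distinct: "j = k \<and> s = t"
    if "\<gamma> j s = \<gamma> k t" "j < 3" "k < 3" "0 < s" "s \<le> 1" "0 < t" "t \<le> 1" for j k s t
  proof -
    have eq: "complex_of_real (\<epsilon> * s) * cis (\<theta> j) = complex_of_real (\<epsilon> * t) * cis (\<theta> k)"
      using inj_onD[OF inj\<kappa> _ in_disc in_disc] that by (simp add: \<gamma>_def)
    from arg_cong[OF this, of norm] have "s = t" using that \<epsilon> by (simp add: norm_mult)
    then show ?thesis using eq that \<epsilon> angle by simp
  qed
  have base: "\<gamma> k 0 = \<xi>" for k by (simp add: \<gamma>_def \<kappa>0)
  have off_base: "\<gamma> k t \<noteq> \<xi>" if "0 < t" "t \<le> 1" for k t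
  proof
    assume "\<gamma> k t = \<xi>"
    then have "complex_of_real (\<epsilon> * t) * cis (\<theta> k) = 0"
      using inj_onD[OF inj\<kappa> _ in_disc, of t k 0] that \<epsilon> by (simp add: \<gamma>_def \<kappa>0)
    then show False using that \<epsilon> by simp
  qed
  have cont\<gamma>: "continuous_on {0..1} (\<gamma> k)" for k
    unfolding \<gamma>_def
    by (rule continuous_on_compose2[OF cont\<kappa>]) (use in_disc in \<open>auto intro!: continuous_intros\<close>)
  have same: "z = w" if "z \<in> S" "w \<in> S" "Re (\<Phi> z) = Re (\<Phi> w)" "v z = v w" for z w
    using inj_onD[OF inj, of z w] that by simp
  obtain j k s t where "j < 3" "k < 3" "j \<noteq> k" "0 < s" "s \<le> 1" "0 < t" "t \<le> 1"
    and "v (\<gamma> j s) - v \<xi> = v (\<gamma> k t) - v \<xi>"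
  proof (rule three_arcs_not_injective[of "\<lambda>k t. v (\<gamma> k t) - v \<xi>"])
    show "continuous_on {0..1} (\<lambda>t. v (\<gamma> k t) - v \<xi>)" for k
      by (intro continuous_intros continuous_on_compose2[OF cont cont\<gamma>]) (use \<gamma>_S in auto)
    show "v (\<gamma> k 0) - v \<xi> = 0" for k by (simp add: base)
    show "v (\<gamma> k t) - v \<xi> \<noteq> 0" if "0 < t" "t \<le> 1" for k t
      using same[of "\<gamma> k t" \<xi>] \<gamma>_S[of t k] level[of t k] off_base[of t k] that S(2) by auto
  qed blast
  then show False
    using same[of "\<gamma> j s" "\<gamma> k t"] distinct[of j s k t] \<gamma>_S[of s j] \<gamma>_S[of t k] level[of s j] level[of t k]
    by auto
qed

section \<open>Conditions at a boundary maximum\<close>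

lemma DERIV_Re_of_real:
  assumes "(F has_field_derivative D) (at (complex_of_real x))"
  shows "((\<lambda>x. Re (F (complex_of_real x))) has_real_derivative Re D) (at x)"
  using bounded_linear.has_vector_derivative[OF bounded_linear_Re has_vector_derivative_real_field[OF assms]]
  by (simp add: has_real_derivative_iff_has_vector_derivative)

lemma second_derivative_at_maximum:
  fixes u u' :: "real \<Rightarrow> real"
  assumes der: "\<And>x. (u has_real_derivative u' x) (at x)"
    and der2: "(u' has_real_derivative m) (at 0)" and max: "\<And>x. u x \<le> u 0"
  shows "u' 0 = 0" and "m \<le> 0"
proof -
  show crit: "u' 0 = 0"
    by (rule DERIV_local_max[OF der[of 0], of 1]) (use max in auto)
  show "m \<le> 0"
  proof (rule ccontr)
    assume "\<not> m \<le> 0"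
    then obtain d where d: "0 < d" "\<And>h. 0 < h \<Longrightarrow> h < d \<Longrightarrow> u' 0 < u' (0 + h)"
      using DERIV_pos_inc_right[OF der2] by auto
    have "u 0 < u (d/2)"
    proof (rule DERIV_pos_imp_increasing_open[of 0 "d/2" u])
      show "\<exists>y. (u has_real_derivative y) (at x) \<and> 0 < y" if "0 < x" "x < d/2" for x
        using der[of x] d(2)[of x] that crit d(1) by auto
      show "continuous_on {0..d/2} u"
        by (intro continuous_at_imp_continuous_on ballI DERIV_isCont[OF der])
    qed (use d in auto)
    then show False using max[of "d/2"] by linarith
  qed
qed

text \<open>Along the circle through the boundary point \<open>c + \<zeta>\<close> the function \<open>Re \<Phi>\<close> has a maximum there, so its
first angular derivative vanishes and its second one is non-positive; along the radius it cannot
increase inwards. The three conclusions express these facts by the complex derivatives of \<open>\<Phi>\<close>.\<close>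

lemma boundary_maximum_conditions:
  fixes \<Phi> :: "complex \<Rightarrow> complex"
  assumes hol: "\<Phi> holomorphic_on S" and S: "open S" "cball c (norm \<zeta>) \<subseteq> S" and \<zeta>: "\<zeta> \<noteq> 0"
    and max: "\<And>w. w \<in> cball c (norm \<zeta>) \<Longrightarrow> Re (\<Phi> w) \<le> Re (\<Phi> (c + \<zeta>))"
  shows "Im (\<zeta> * deriv \<Phi> (c + \<zeta>)) = 0" and "0 \<le> Re (\<zeta> * deriv \<Phi> (c + \<zeta>))"
    and "0 \<le> Re (\<zeta> * deriv \<Phi> (c + \<zeta>) + \<zeta>\<^sup>2 * deriv (deriv \<Phi>) (c + \<zeta>))"
proof -
  have d1: "(\<Phi> has_field_derivative deriv \<Phi> w) (at w)" if "w \<in> S" for w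
    using hol S(1) that by (simp add: holomorphic_derivI)
  have d2: "(deriv \<Phi> has_field_derivative deriv (deriv \<Phi>) w) (at w)" if "w \<in> S" for w
    by (rule holomorphic_derivI[OF holomorphic_deriv[OF hol S(1)] S(1) that])
  define p where "p = (\<lambda>x. c + \<zeta> * exp (\<i> * x))"
  have p_norm: "p (complex_of_real x) \<in> cball c (norm \<zeta>)" for x
    by (simp add: p_def dist_norm norm_mult)
  have p_S: "p (complex_of_real x) \<in> S" for x
    using p_norm S(2) by blast
  define u where "u = (\<lambda>x. Re (\<Phi> (p (complex_of_real x))))"
  define u' where "u' = (\<lambda>x. Re (deriv \<Phi> (p (complex_of_real x)) * (\<zeta> * (\<i> * exp (\<i> * x)))))"
  have dp: "(p has_field_derivative \<zeta> * (\<i> * exp (\<i> * x))) (at x)" for x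
    unfolding p_def by (auto intro!: derivative_eq_intros)
  have du: "(u has_real_derivative u' x) (at x)" for x
    unfolding u_def u'_def
    by (intro DERIV_Re_of_real DERIV_chain2[OF d1[OF p_S] dp])
  have "((\<lambda>x. deriv \<Phi> (p x) * (\<zeta> * (\<i> * exp (\<i> * x)))) has_field_derivative
      - (\<zeta> * deriv \<Phi> (c + \<zeta>) + \<zeta>\<^sup>2 * deriv (deriv \<Phi>) (c + \<zeta>))) (at (complex_of_real 0))"
    by (rule derivative_eq_intros DERIV_chain2[OF d2[OF p_S] dp] refl)+
      (simp add: p_def power2_eq_square algebra_simps)
  from DERIV_Re_of_real[OF this]
  have du2: "(u' has_real_derivative - Re (\<zeta> * deriv \<Phi> (c + \<zeta>) + \<zeta>\<^sup>2 * deriv (deriv \<Phi>) (c + \<zeta>))) (at 0)"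
    by (simp only: u'_def uminus_complex.sel)
  have umax: "u x \<le> u 0" for x
    using max[OF p_norm] by (simp add: u_def p_def)
  from second_derivative_at_maximum[OF du du2 umax]
  show "Im (\<zeta> * deriv \<Phi> (c + \<zeta>)) = 0"
    and "0 \<le> Re (\<zeta> * deriv \<Phi> (c + \<zeta>) + \<zeta>\<^sup>2 * deriv (deriv \<Phi>) (c + \<zeta>))"
    by (auto simp: u'_def p_def algebra_simps)
  have "c + \<zeta> \<in> S" using S(2) by (auto simp: dist_norm)
  then have "((\<lambda>x. \<Phi> (c + x * \<zeta>)) has_field_derivative deriv \<Phi> (c + \<zeta>) * \<zeta>) (at (complex_of_real 1))"
    by (intro DERIV_chain2[of \<Phi>]) (auto intro!: derivative_eq_intros d1)
  from DERIV_Re_of_real[OF this]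
  have rad: "((\<lambda>x. Re (\<Phi> (c + x * \<zeta>))) has_real_derivative Re (\<zeta> * deriv \<Phi> (c + \<zeta>))) (at 1)"
    by (simp add: mult.commute)
  show "0 \<le> Re (\<zeta> * deriv \<Phi> (c + \<zeta>))"
  proof (rule ccontr)
    assume "\<not> ?thesis"
    then obtain d where d: "0 < d"
      "\<And>h. 0 < h \<Longrightarrow> h < d \<Longrightarrow> Re (\<Phi> (c + 1 * \<zeta>)) < Re (\<Phi> (c + complex_of_real (1 - h) * \<zeta>))"
      using DERIV_neg_dec_left[OF rad] by auto
    define h where "h = min (d/2) (1/2)"
    have h: "0 < h" "h < d" "h < 1" using d(1) by (auto simp: h_def)
    have "c + complex_of_real (1 - h) * \<zeta> \<in> cball c (norm \<zeta>)"
      using h by (simp add: dist_norm norm_mult mult_left_le_one_le del: of_real_diff)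
    from max[OF this] d(2)[OF h(1,2)] show False by simp
  qed
qed

section \<open>Schwarz-Pick and curvature inequalities\<close>

text \<open>The Schwarz lemma applied to \<open>\<omega>\<close> conjugated by the disc automorphisms that move \<open>z\<close> and \<open>\<omega> z\<close>
to 0.\<close>

lemma Schwarz_Pick_derivative:
  assumes hol: "\<omega> holomorphic_on ball 0 1" and less: "\<And>z. norm z < 1 \<Longrightarrow> norm (\<omega> z) < 1"
    and z: "norm z < 1"
  shows "norm (deriv \<omega> z) * (1 - (norm z)\<^sup>2) \<le> 1 - (norm (\<omega> z))\<^sup>2"
proof -
  define a where "a = \<omega> z"
  have a: "norm a < 1" using less z by (simp add: a_def)
  have na: "0 < 1 - (norm a)\<^sup>2" using a by (simp add: power_less_one_iff)
  let ?M = "Moebius_function 0"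
  define F where "F = ?M a \<circ> \<omega> \<circ> ?M (- z)"
  have maps: "norm (?M w y) < 1" if "norm w < 1" "norm y < 1" for w y
    using Moebius_function_norm_lt_1 that by auto
  have holM: "?M w holomorphic_on ball 0 1" if "norm w < 1" for w
    using Moebius_function_holomorphic that by auto
  have holF: "F holomorphic_on ball 0 1"
    unfolding F_def o_assoc[symmetric]
    using z a less maps holM hol
    by (intro holomorphic_on_compose_gen[where t = "ball 0 1"]) auto
  have M0: "?M (- z) 0 = z" by (simp add: Moebius_function_def)
  have F0: "F 0 = 0" using M0 by (simp add: F_def a_def Moebius_function_eq_zero)
  have normF: "norm (F y) < 1" if "norm y < 1" for y
    using that z a less maps by (simp add: F_def)
  have "(?M (- z) has_field_derivative (1 - z * cnj z)) (at 0)"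
    unfolding Moebius_function_simple by (auto intro!: derivative_eq_intros)
  moreover have "(\<omega> has_field_derivative deriv \<omega> z) (at (?M (- z) 0))"
    using hol z M0 by (simp add: holomorphic_derivI)
  moreover have "(?M a has_field_derivative 1 / (1 - cnj a * a)) (at (\<omega> (?M (- z) 0)))"
  proof -
    have "1 - cnj a * a \<noteq> 0"
      using na by (metis complex_norm_square mult.commute of_real_1 of_real_diff of_real_eq_0_iff less_irrefl)
    then have "(?M a has_field_derivative 1 / (1 - cnj a * a)) (at a)"
      unfolding Moebius_function_simple
      by (auto intro!: derivative_eq_intros)
    then show ?thesis by (simp add: M0 a_def)
  qed
  ultimately have "(F has_field_derivative 1 / (1 - cnj a * a) * deriv \<omega> z * (1 - z * cnj z)) (at 0)"
    unfolding F_def by (intro DERIV_chain) auto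
  then have "deriv F 0 = 1 / (1 - cnj a * a) * deriv \<omega> z * (1 - z * cnj z)"
    by (rule DERIV_imp_deriv)
  moreover have "norm (1 - z * cnj z) = 1 - (norm z)\<^sup>2" "norm (1 - cnj a * a) = 1 - (norm a)\<^sup>2"
  proof -
    have "1 - z * cnj z = complex_of_real (1 - (norm z)\<^sup>2)" "1 - cnj a * a = complex_of_real (1 - (norm a)\<^sup>2)"
      by (simp_all add: complex_norm_square[symmetric] mult.commute[of "cnj a"])
    then show "norm (1 - z * cnj z) = 1 - (norm z)\<^sup>2" "norm (1 - cnj a * a) = 1 - (norm a)\<^sup>2"
      using na z by (simp_all add: power_le_one del: of_real_diff)
  qed
  ultimately have "norm (deriv \<omega> z) * (1 - (norm z)\<^sup>2) / (1 - (norm a)\<^sup>2) \<le> 1"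
    using Schwarz_Lemma(2)[OF holF F0 normF, of 0] by (simp add: norm_mult norm_divide)
  then show ?thesis using na by (simp add: a_def)
qed

text \<open>The constant \<open>sqrt 3\<close> of the coefficient estimate originates here. Rotate so that \<open>A\<close> points in the
least favourable direction, and average over the two directions at angles \<open>\<plusminus> pi / 6\<close> from it: their
cubes are opposite, so \<open>B\<close> drops out, while \<open>A\<close> keeps the weight \<open>cos (pi / 6)\<close>.\<close>

lemma cubic_exponential_coefficient_bound:
  fixes A B :: complex
  assumes nonneg: "\<And>e. norm e = 1 \<Longrightarrow> 0 \<le> 2 * J + Re (e * A + e ^ 3 * B)"
  shows "norm A \<le> 4 / sqrt 3 * J"
proof -
  obtain e where e: "norm e = 1" "e * A = - complex_of_real (norm A)"
  proof (cases "A = 0")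
    case True then show ?thesis using that[of 1] by simp
  next
    case False
    then have "- (cnj A / norm A) * A = - complex_of_real (norm A)"
      by (simp add: field_simps complex_norm_square power2_eq_square[symmetric] flip: of_real_power)
    moreover have "norm (- (cnj A / norm A)) = 1" using False by (simp add: norm_divide)
    ultimately show ?thesis using that by blast
  qed
  let ?p = "cis (pi / 6)" and ?q = "cis (- (pi / 6))"
  have sum: "?p + ?q = sqrt 3"
    by (simp add: complex_eq_iff cos_30 sin_30)
  have "?p ^ 3 + ?q ^ 3 = cis (pi / 2) + cis (- (pi / 2))"
    by (simp add: Complex.DeMoivre)
  then have cubes: "?p ^ 3 + ?q ^ 3 = 0" by (simp add: complex_eq_iff)
  have "0 \<le> (2 * J + Re (e * ?p * A + (e * ?p) ^ 3 * B)) + (2 * J + Re (e * ?q * A + (e * ?q) ^ 3 * B))"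
    by (intro add_nonneg_nonneg nonneg) (simp_all add: norm_mult e)
  also have "\<dots> = 4 * J + Re ((e * A) * (?p + ?q) + e ^ 3 * (?p ^ 3 + ?q ^ 3) * B)"
    by (simp add: power_mult_distrib algebra_simps)
  also have "\<dots> = 4 * J - sqrt 3 * norm A"
    unfolding sum cubes e(2) by simp
  finally show ?thesis by (simp add: field_simps)
qed

text \<open>The elimination of the normal direction \<open>n\<close> of a support line; \<open>h1\<close>, \<open>h2\<close>, \<open>g1\<close>, \<open>g2\<close> stand for the
first and second derivatives of \<open>h\<close> and \<open>g\<close> at a point of a circle with outer normal \<open>e\<close>. The equation \<open>normal\<close> together with its conjugate is a
linear system for \<open>n\<close> and \<open>cnj n\<close> with determinant \<open>J\<close> up to a factor; substituting its solution into
\<open>second\<close> leaves an inequality that does not mention \<open>n\<close>, and says that the image of the circle of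
radius \<open>\<rho>\<close> has non-negative curvature.\<close>

lemma curvature_from_support_line:
  fixes h1 h2 g1 g2 n e :: complex and \<rho> k :: real
  defines "J \<equiv> (norm h1)\<^sup>2 - (norm g1)\<^sup>2"
  assumes e: "norm e = 1" and \<rho>: "0 < \<rho>" and k: "0 < k" and J: "0 \<le> J"
    and normal: "complex_of_real \<rho> * e * (cnj n * h1 + n * g1) = k"
    and second: "0 \<le> Re (k + (complex_of_real \<rho> * e)\<^sup>2 * (cnj n * h2 + n * g2))"
  shows "0 \<le> J + \<rho> * Re (e * (cnj h1 * h2 - cnj g1 * g2) + e ^ 3 * (h1 * g2 - g1 * h2))"
proof -
  have ee: "e * cnj e = 1" using e by (simp add: complex_norm_square[symmetric])
  have Jc: "complex_of_real J = h1 * cnj h1 - g1 * cnj g1"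
    unfolding J_def of_real_diff complex_norm_square ..
  have normal': "complex_of_real \<rho> * cnj e * (n * cnj h1 + cnj n * cnj g1) = k"
    using arg_cong[OF normal, of cnj] by simp
  have solve: "complex_of_real \<rho> * J * n = k * (h1 * e - cnj g1 * cnj e)"
  proof -
    have "complex_of_real \<rho> * J * n
        = (e * cnj e) * complex_of_real \<rho> * (n * cnj h1 + cnj n * cnj g1) * h1
          - (e * cnj e) * complex_of_real \<rho> * (cnj n * h1 + n * g1) * cnj g1"
      unfolding ee Jc by (simp add: algebra_simps)
    also have "\<dots> = e * h1 * (complex_of_real \<rho> * cnj e * (n * cnj h1 + cnj n * cnj g1))
        - cnj e * cnj g1 * (complex_of_real \<rho> * e * (cnj n * h1 + n * g1))"
      by (simp add: algebra_simps)
    also have "\<dots> = k * (h1 * e - cnj g1 * cnj e)"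
      unfolding normal normal' by (simp add: algebra_simps)
    finally show ?thesis .
  qed
  have solve': "complex_of_real \<rho> * J * cnj n = k * (cnj h1 * cnj e - g1 * e)"
    using arg_cong[OF solve, of cnj] by simp
  have "complex_of_real J * (k + (complex_of_real \<rho> * e)\<^sup>2 * (cnj n * h2 + n * g2))
      = J * k + \<rho> * e\<^sup>2 * ((complex_of_real \<rho> * J * cnj n) * h2 + (complex_of_real \<rho> * J * n) * g2)"
    by (simp add: power2_eq_square algebra_simps)
  also have "\<dots> = J * k + \<rho> * k * (e * ((e * cnj e) * (cnj h1 * h2 - cnj g1 * g2)) + e ^ 3 * (h1 * g2 - g1 * h2))"
    unfolding solve solve' by (simp add: power2_eq_square power3_eq_cube algebra_simps)
  also have "\<dots> = complex_of_real k * (J + complex_of_real \<rho> * (e * (cnj h1 * h2 - cnj g1 * g2) + e ^ 3 * (h1 * g2 - g1 * h2)))"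
    unfolding ee by (simp add: algebra_simps)
  finally have calc: "complex_of_real J * (k + (complex_of_real \<rho> * e)\<^sup>2 * (cnj n * h2 + n * g2))
      = complex_of_real k * (J + complex_of_real \<rho> * (e * (cnj h1 * h2 - cnj g1 * g2) + e ^ 3 * (h1 * g2 - g1 * h2)))" .
  have scale: "Re (complex_of_real a * z) = a * Re z" for a z by simp
  have "J * Re (k + (complex_of_real \<rho> * e)\<^sup>2 * (cnj n * h2 + n * g2))
      = k * (J + \<rho> * Re (e * (cnj h1 * h2 - cnj g1 * g2) + e ^ 3 * (h1 * g2 - g1 * h2)))"
    using arg_cong[OF calc, of Re] by (simp only: scale plus_complex.sel Re_complex_of_real)
  then show ?thesis
    using mult_nonneg_nonneg[OF J second] k by (simp add: zero_le_mult_iff)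
qed

section \<open>Injectivity near a compact disc\<close>

text \<open>Otherwise there are pairs of distinct points with equal images at distance from the closed disc
tending to 0. By compactness they accumulate at a pair in the disc with equal images, hence at a
single point, where local injectivity is violated.\<close>

lemma inj_on_neighbourhood_of_cball:
  fixes f :: "complex \<Rightarrow> complex"
  assumes cont: "continuous_on S f" and S: "open S" "cball 0 s \<subseteq> S"
    and inj: "inj_on f (cball 0 s)"
    and loc: "\<And>z. z \<in> cball 0 s \<Longrightarrow> \<exists>U. open U \<and> z \<in> U \<and> inj_on f U"
  shows "\<exists>t>s. inj_on f (ball 0 t)"
proof (rule ccontr)
  assume not_inj: "\<not> ?thesis"
  define t where "t = (\<lambda>n. s + inverse (real (Suc n)))"
  have "\<exists>p q. p \<in> ball 0 (t n) \<and> q \<in> ball 0 (t n) \<and> p \<noteq> q \<and> f p = f q" for n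
  proof -
    have "\<not> inj_on f (ball 0 (t n))" using not_inj by (auto simp: t_def)
    then show ?thesis unfolding inj_on_def by blast
  qed
  then obtain p q where pq: "\<And>n. p n \<in> ball 0 (t n)" "\<And>n. q n \<in> ball 0 (t n)"
    "\<And>n. p n \<noteq> q n" "\<And>n. f (p n) = f (q n)"
    by metis
  have "t n \<le> s + 1" for n by (simp add: t_def field_simps)
  then have "(p n, q n) \<in> cball 0 (s + 1) \<times> cball 0 (s + 1)" for n
    using pq(1,2)[of n] by (auto intro: less_imp_le less_le_trans)
  moreover have "compact (cball (0::complex) (s + 1) \<times> cball (0::complex) (s + 1))"
    by (intro compact_Times compact_cball)
  ultimately obtain l r where r: "strict_mono (r :: nat \<Rightarrow> nat)" "((\<lambda>n. (p n, q n)) \<circ> r) \<longlonglongrightarrow> l"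
    unfolding compact_def by (metis (no_types, lifting))
  then have lim: "(\<lambda>n. p (r n)) \<longlonglongrightarrow> fst l" "(\<lambda>n. q (r n)) \<longlonglongrightarrow> snd l"
    using tendsto_fst[OF r(2)] tendsto_snd[OF r(2)] by (simp_all add: o_def)
  have "t \<longlonglongrightarrow> s"
    unfolding t_def using tendsto_add[OF tendsto_const LIMSEQ_inverse_real_of_nat, of s] by simp
  then have limt: "(\<lambda>n. t (r n)) \<longlonglongrightarrow> s"
    using LIMSEQ_subseq_LIMSEQ[OF _ r(1)] by (simp add: o_def)
  have in_cball: "fst l \<in> cball 0 s" "snd l \<in> cball 0 s"
    using LIMSEQ_le[OF tendsto_norm[OF lim(1)] limt] LIMSEQ_le[OF tendsto_norm[OF lim(2)] limt] pq(1,2)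
    by (auto simp: less_imp_le)
  then have "isCont f (fst l)" "isCont f (snd l)"
    using cont S by (auto simp: continuous_on_eq_continuous_at)
  then have "(\<lambda>n. f (p (r n))) \<longlonglongrightarrow> f (fst l)" "(\<lambda>n. f (q (r n))) \<longlonglongrightarrow> f (snd l)"
    using lim by (auto intro: isCont_tendsto_compose)
  then have "f (fst l) = f (snd l)"
    using pq(4) LIMSEQ_unique by simp
  then have same: "fst l = snd l"
    using inj in_cball by (auto dest: inj_onD)
  obtain U where U: "open U" "fst l \<in> U" "inj_on f U"
    using loc[OF in_cball(1)] by blast
  have "\<forall>\<^sub>F n in sequentially. p (r n) \<in> U \<and> q (r n) \<in> U"
    using topological_tendstoD[OF lim(1) U(1,2)] topological_tendstoD[OF lim(2) U(1)] U(2) same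
    by (simp add: eventually_conj)
  then obtain n where "p (r n) \<in> U" "q (r n) \<in> U"
    by (auto simp: eventually_sequentially)
  then show False using pq(3,4)[of "r n"] inj_onD[OF U(3)] by blast
qed

section \<open>Absolutely convex harmonic mappings\<close>

text \<open>The normalisation of the power series of \<open>h\<close> and \<open>g\<close> enters through the values at 0 that it fixes.\<close>

locale absolutely_convex_map =
  fixes f h g :: "complex \<Rightarrow> complex"
  assumes hol_h: "h holomorphic_on unit_disc" and hol_g: "g holomorphic_on unit_disc"
    and decomposition: "z \<in> unit_disc \<Longrightarrow> f z = h z + cnj (g z)"
    and locally_inj: "locally_univalent f"
    and convex_image: "0 < r \<Longrightarrow> norm c + r < 1 \<Longrightarrow> convex (f ` ball c r)"
    and f_0: "f 0 = 0" and deriv_h_0: "deriv h 0 = 1" and deriv_g_0: "deriv g 0 = 0"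
begin

definition jacobian :: "complex \<Rightarrow> real" where
  "jacobian z = (norm (deriv h z))\<^sup>2 - (norm (deriv g z))\<^sup>2"

text \<open>The real part of this holomorphic function is the component of \<open>f\<close> in the direction \<open>n\<close>. It
translates statements about support lines of an image into statements about one holomorphic
function.\<close>

definition directional :: "complex \<Rightarrow> complex \<Rightarrow> complex" where
  "directional n z = cnj n * h z + n * g z"

definition differential :: "complex \<Rightarrow> complex \<Rightarrow> complex" where
  "differential z u = deriv h z * u + cnj (deriv g z * u)"

definition inverse_differential :: "complex \<Rightarrow> complex \<Rightarrow> complex" where
  "inverse_differential z w =
     (cnj (deriv h z) * w - cnj (deriv g z) * cnj w) / complex_of_real (jacobian z)"

lemma Re_directional: "z \<in> unit_disc \<Longrightarrow> Re (directional n z) = Re (cnj n * f z)"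
  by (simp add: directional_def decomposition algebra_simps)

lemma holomorphic_directional: "directional n holomorphic_on unit_disc"
  unfolding directional_def[abs_def] by (intro holomorphic_intros hol_h hol_g)

lemma
  assumes "z \<in> unit_disc"
  shows DERIV_h: "(h has_field_derivative deriv h z) (at z)"
    and DERIV_g: "(g has_field_derivative deriv g z) (at z)"
    and DERIV_deriv_h: "(deriv h has_field_derivative deriv (deriv h) z) (at z)"
    and DERIV_deriv_g: "(deriv g has_field_derivative deriv (deriv g) z) (at z)"
  using assms by (auto intro!: holomorphic_derivI[of _ unit_disc] holomorphic_deriv hol_h hol_g)

lemma deriv_directional:
  "z \<in> unit_disc \<Longrightarrow> deriv (directional n) z = cnj n * deriv h z + n * deriv g z"
  unfolding directional_def[abs_def]
  by (intro DERIV_imp_deriv) (auto intro!: derivative_eq_intros DERIV_h DERIV_g)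

lemma deriv2_directional:
  assumes z: "z \<in> unit_disc"
  shows "deriv (deriv (directional n)) z = cnj n * deriv (deriv h) z + n * deriv (deriv g) z"
proof (rule DERIV_imp_deriv, rule has_field_derivative_transform_within_open[OF _ open_ball z])
  show "((\<lambda>w. cnj n * deriv h w + n * deriv g w) has_field_derivative
      cnj n * deriv (deriv h) z + n * deriv (deriv g) z) (at z)"
    by (auto intro!: derivative_eq_intros DERIV_deriv_h[OF z] DERIV_deriv_g[OF z])
qed (use z in \<open>auto simp: deriv_directional\<close>)

lemma has_derivative_f:
  assumes "z \<in> unit_disc"
  shows "(f has_derivative differential z) (at z)"
proof -
  have "((\<lambda>w. h w + cnj (g w)) has_derivative differential z) (at z)"
    using DERIV_h[OF assms] DERIV_g[OF assms] unfolding has_field_derivative_def differential_def[abs_def]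
    by (intro has_derivative_add has_derivative_cnj)
  then show ?thesis
    by (rule has_derivative_transform_within_open[OF _ open_ball assms]) (use decomposition in auto)
qed

lemma continuous_f: "continuous_on unit_disc f"
  by (meson continuous_at_imp_continuous_on has_derivative_continuous has_derivative_f)

section \<open>Positivity of the Jacobian\<close>

text \<open>This is Lewy's theorem. Where the Jacobian vanishes, \<open>h'\<close> and \<open>g'\<close> have equal modulus, so some
component of \<open>f\<close> is the real part of a holomorphic function with a critical point, which is
incompatible with local injectivity.\<close>

lemma jacobian_nonzero:
  assumes z: "z \<in> unit_disc"
  shows "jacobian z \<noteq> 0"
proof
  assume "jacobian z = 0"
  then have eq: "norm (deriv h z) = norm (deriv g z)"
    by (simp add: jacobian_def)
  obtain n where n: "n \<noteq> 0" "cnj n * deriv h z + n * deriv g z = 0"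
  proof (cases "deriv g z = 0")
    case True
    then show ?thesis using eq that[of 1] by simp
  next
    case False
    \<comment> \<open>A square root makes \<open>n / cnj n\<close> equal to the given unimodular number.\<close>
    define n where "n = csqrt (- (deriv h z / deriv g z))"
    have sq: "n\<^sup>2 = - (deriv h z / deriv g z)" by (simp add: n_def)
    have "norm (n\<^sup>2) = 1" using sq eq False by (simp add: norm_divide)
    then have norm_n: "norm n = 1" using norm_ge_zero[of n] by (auto simp: norm_power power2_eq_1_iff simp del: norm_ge_zero)
    then have unit: "n * cnj n = 1" by (simp add: complex_norm_square[symmetric])
    have "n * (cnj n * deriv h z + n * deriv g z) = (n * cnj n) * deriv h z + n\<^sup>2 * deriv g z"
      by (simp add: power2_eq_square algebra_simps)
    also have "\<dots> = 0" unfolding unit sq using False by simp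
    finally have "cnj n * deriv h z + n * deriv g z = 0" using norm_n by auto
    then show ?thesis using that[of n] norm_n by force
  qed
  obtain U where U: "open U" "z \<in> U" "U \<subseteq> unit_disc" "inj_on f U"
    using locally_inj z unfolding locally_univalent_def by blast
  have "\<not> inj_on (\<lambda>w. (Re (directional n w), Im (cnj n * f w))) U"
  proof (rule critical_point_not_injective)
    show "directional n holomorphic_on U"
      using holomorphic_directional U(3) holomorphic_on_subset by blast
    show "deriv (directional n) z = 0" using n(2) z by (simp add: deriv_directional)
    show "continuous_on U (\<lambda>w. Im (cnj n * f w))"
      by (intro continuous_intros continuous_on_subset[OF continuous_f U(3)])
  qed (use U in auto)
  moreover have "inj_on (\<lambda>w. (Re (directional n w), Im (cnj n * f w))) U"
  proof (rule inj_onI)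
    fix v w assume vw: "v \<in> U" "w \<in> U"
      and "(Re (directional n v), Im (cnj n * f v)) = (Re (directional n w), Im (cnj n * f w))"
    moreover have "v \<in> unit_disc" "w \<in> unit_disc" using vw U(3) by blast+
    ultimately have "cnj n * f v = cnj n * f w"
      by (intro complex_eqI) (simp_all only: prod.inject Re_directional)
    then show "v = w" using n(1) inj_onD[OF U(4) _ vw] by simp
  qed
  ultimately show False by contradiction
qed

lemma jacobian_pos:
  assumes z: "z \<in> unit_disc"
  shows "0 < jacobian z"
proof (rule ccontr)
  assume neg: "\<not> 0 < jacobian z"
  have "connected (jacobian ` unit_disc)"
    unfolding jacobian_def[abs_def]
    by (intro connected_continuous_image continuous_intros connected_ball holomorphic_on_imp_continuous_on
        holomorphic_deriv hol_h hol_g open_ball)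
  moreover have "jacobian 0 = 1" by (simp add: jacobian_def deriv_h_0 deriv_g_0)
  then have "1 \<in> jacobian ` unit_disc" by (metis centre_in_ball image_eqI zero_less_one)
  ultimately have "0 \<in> jacobian ` unit_disc"
    using connectedD_interval[of "jacobian ` unit_disc" "jacobian z" 1 0] z neg by auto
  then show False using jacobian_nonzero by auto
qed

lemma deriv_g_less_deriv_h: "z \<in> unit_disc \<Longrightarrow> norm (deriv g z) < norm (deriv h z)"
  using jacobian_pos[of z] by (simp add: jacobian_def power_less_imp_less_base)

section \<open>Local inverses and support lines\<close>

lemma inverse_differential:
  assumes "z \<in> unit_disc"
  shows "differential z (inverse_differential z w) = w"
proof -
  have J: "complex_of_real (jacobian z) = deriv h z * cnj (deriv h z) - deriv g z * cnj (deriv g z)"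
    unfolding jacobian_def of_real_diff complex_norm_square ..
  have "complex_of_real (jacobian z) \<noteq> 0" using jacobian_nonzero[OF assms] by simp
  then have "differential z (inverse_differential z w)
      = (deriv h z * (cnj (deriv h z) * w - cnj (deriv g z) * cnj w)
        + cnj (deriv g z) * (deriv h z * cnj w - deriv g z * w)) / jacobian z"
    by (simp add: differential_def inverse_differential_def add_divide_distrib)
  also have "\<dots> = (complex_of_real (jacobian z) * w) / jacobian z"
    unfolding J by (simp add: algebra_simps)
  finally show ?thesis using jacobian_nonzero[OF assms] by simp
qed

lemma has_derivative_local_inverse:
  assumes U: "open U" "U \<subseteq> unit_disc" "inj_on f U" "z \<in> U"
  shows "(inv_into U f has_derivative inverse_differential z) (at (f z))"
proof (rule has_derivative_inverse_strong[OF U(1,4)])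
  show "continuous_on U f" using continuous_f U(2) continuous_on_subset by blast
  show "(f has_derivative differential z) (at z)" using has_derivative_f U by blast
  show "differential z \<circ> inverse_differential z = id"
    using inverse_differential U by (auto simp: fun_eq_iff subset_eq)
qed (use U in auto)

lemma open_image:
  assumes "open U" "U \<subseteq> unit_disc" "inj_on f U"
  shows "open (f ` U)"
  using assms continuous_f continuous_on_subset by (blast intro: invariance_of_domain)

lemma support_line:
  assumes "0 < r" "norm c + r < 1" and w: "w \<notin> f ` ball c r"
  obtains n where "n \<noteq> 0" "\<And>z. z \<in> ball c r \<Longrightarrow> Re (cnj n * f z) \<le> Re (cnj n * w)"
proof -
  have "f ` ball c r \<noteq> {}" using \<open>0 < r\<close> by auto
  then obtain a b where a: "a \<noteq> 0" "a \<bullet> w \<le> b" "\<And>x. x \<in> f ` ball c r \<Longrightarrow> a \<bullet> x \<ge> b"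
    using separating_hyperplane_set_point_inaff[OF convex_image[OF assms(1,2)] _ w] by metis
  show ?thesis
  proof (rule that[of "- a"])
    fix z assume "z \<in> ball c r"
    then have "a \<bullet> w \<le> a \<bullet> f z" using a by force
    then show "Re (cnj (- a) * f z) \<le> Re (cnj (- a) * w)"
      by (simp add: inner_complex_def)
  qed (use a in auto)
qed

text \<open>The boundary maximum conditions for \<open>directional n\<close>, with the first of them sharpened: \<open>k\<close> is strictly
positive, because \<open>directional n\<close> has no critical point when the Jacobian is positive.\<close>

lemma support_line_at_boundary_point:
  assumes \<zeta>: "\<zeta> \<noteq> 0" "norm c + norm \<zeta> < 1" and n: "n \<noteq> 0"
    and max: "\<And>z. z \<in> ball c (norm \<zeta>) \<Longrightarrow> Re (cnj n * f z) \<le> Re (cnj n * f (c + \<zeta>))"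
  obtains k :: real where "0 < k" "\<zeta> * deriv (directional n) (c + \<zeta>) = k"
    "0 \<le> Re (k + \<zeta>\<^sup>2 * deriv (deriv (directional n)) (c + \<zeta>))"
proof -
  have sub: "cball c (norm \<zeta>) \<subseteq> unit_disc"
    using \<zeta>(2) by (auto simp: dist_norm) (metis norm_minus_commute norm_triangle_sub add_le_cancel_left le_less_trans order_trans)
  have edge: "c + \<zeta> \<in> cball c (norm \<zeta>)" by (simp add: dist_norm)
  have le: "Re (directional n w) \<le> Re (directional n (c + \<zeta>))" if w: "w \<in> cball c (norm \<zeta>)" for w
  proof -
    have closure: "closure (ball c (norm \<zeta>)) = cball c (norm \<zeta>)" using \<zeta>(1) by simp
    have "continuous_on (closure (ball c (norm \<zeta>))) (\<lambda>w. Re (directional n w))"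
      unfolding closure
      by (intro continuous_intros holomorphic_on_imp_continuous_on holomorphic_on_subset[OF holomorphic_directional sub])
    then show ?thesis
    proof (rule continuous_le_on_closure)
      show "w \<in> closure (ball c (norm \<zeta>))" using w closure by simp
      show "Re (directional n y) \<le> Re (directional n (c + \<zeta>))" if "y \<in> ball c (norm \<zeta>)" for y
        using max[OF that] that sub edge by (simp add: Re_directional subset_eq)
    qed
  qed
  note conditions = boundary_maximum_conditions[OF holomorphic_directional open_ball sub \<zeta>(1) le]
  define k where "k = Re (\<zeta> * deriv (directional n) (c + \<zeta>))"
  have k: "\<zeta> * deriv (directional n) (c + \<zeta>) = k"
    using conditions(1) by (auto simp: k_def intro: complex_eqI)
  have inD: "c + \<zeta> \<in> unit_disc" using sub edge by blast
  have "k \<noteq> 0"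
  proof
    assume "k = 0"
    then have "cnj n * deriv h (c + \<zeta>) = - (n * deriv g (c + \<zeta>))"
      using k \<zeta>(1) deriv_directional[OF inD, of n] by (simp add: add_eq_0_iff)
    from arg_cong[OF this, of norm] have "norm (deriv h (c + \<zeta>)) = norm (deriv g (c + \<zeta>))"
      using n by (simp add: norm_mult)
    then show False using deriv_g_less_deriv_h[OF inD] by simp
  qed
  then have "0 < k" using conditions(2) by (simp add: k_def)
  then show ?thesis using that[OF _ k] conditions(3) k by simp
qed

text \<open>The derivative of the local inverse of \<open>f\<close> sends the inner normal \<open>- n\<close> to a vector that strictly
decreases the modulus. Hence all points on the inner normal close to \<open>f z\<close> have preimages near
\<open>z\<close> in the open disc of radius \<open>norm z\<close>.\<close>

lemma inward_preimages:
  assumes U: "open U" "U \<subseteq> unit_disc" "inj_on f U" "z \<in> U"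
    and z: "z \<noteq> 0" and n: "n \<noteq> 0" and k: "0 < k" "z * deriv (directional n) z = complex_of_real k"
  obtains d where "0 < d" "\<And>t. 0 < t \<Longrightarrow> t < d \<Longrightarrow> \<exists>y\<in>U. norm y < norm z \<and> f y = f z - of_real t * n"
proof -
  have zD: "z \<in> unit_disc" using U by blast
  define u where "u = inverse_differential z (- n)"
  define \<gamma> where "\<gamma> = (\<lambda>t. inv_into U f (f z - complex_of_real t * n))"
  have \<gamma>0: "\<gamma> 0 = z" using U by (simp add: \<gamma>_def)
  have der: "(\<gamma> has_vector_derivative u) (at 0)"
  proof -
    have "(\<gamma> has_derivative (\<lambda>t. inverse_differential z (- complex_of_real t * n))) (at 0)"
      unfolding \<gamma>_def
      by (rule has_derivative_compose[where g = "inv_into U f"])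
        (auto intro!: derivative_eq_intros has_derivative_local_inverse U)
    moreover have "inverse_differential z (- complex_of_real t * n) = t *\<^sub>R u" for t
      by (simp add: u_def inverse_differential_def scaleR_conv_of_real algebra_simps)
    ultimately show ?thesis by (simp add: has_vector_derivative_def)
  qed
  then have "((\<lambda>t. \<gamma> t \<bullet> \<gamma> t) has_real_derivative 2 * (z \<bullet> u)) (at 0)"
    unfolding has_vector_derivative_def has_field_derivative_def
    by (auto intro!: derivative_eq_intros simp: \<gamma>0 inner_commute)
  moreover have "2 * (z \<bullet> u) < 0"
  proof -
    have "- (norm n)\<^sup>2 = Re (cnj n * differential z u)"
      unfolding u_def inverse_differential[OF zD] cmod_power2 by (simp add: power2_eq_square)
    also have "\<dots> = Re (deriv (directional n) z * u)"
      by (simp add: differential_def deriv_directional[OF zD] algebra_simps)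
    also have "deriv (directional n) z = complex_of_real (k / (norm z)\<^sup>2) * cnj z"
      using k(2) z unfolding of_real_divide complex_norm_square by (simp add: field_simps)
    also have "Re (complex_of_real (k / (norm z)\<^sup>2) * cnj z * u) = k / (norm z)\<^sup>2 * (z \<bullet> u)"
      by (simp add: inner_complex_def add_divide_distrib algebra_simps)
    finally have "k / (norm z)\<^sup>2 * (z \<bullet> u) = - (norm n)\<^sup>2" ..
    moreover have "- (norm n)\<^sup>2 < 0" "0 < k / (norm z)\<^sup>2" using n k(1) z by simp_all
    ultimately show ?thesis by (metis mult_less_cancel_left_pos mult_zero_right mult.commute zero_less_numeral)
  qed
  ultimately obtain d where d: "0 < d" "\<And>t. 0 < t \<Longrightarrow> t < d \<Longrightarrow> \<gamma> t \<bullet> \<gamma> t < z \<bullet> z"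
    using DERIV_neg_dec_right[of "\<lambda>t. \<gamma> t \<bullet> \<gamma> t" "2 * (z \<bullet> u)" 0] \<gamma>0 by auto
  obtain \<delta> where \<delta>: "0 < \<delta>" "ball (f z) \<delta> \<subseteq> f ` U"
    using open_image[OF U(1-3)] U(4) by (meson image_eqI openE)
  show ?thesis
  proof (rule that[of "min d (\<delta> / norm n)"])
    show "0 < min d (\<delta> / norm n)" using d \<delta> n by simp
    fix t assume t: "0 < t" "t < min d (\<delta> / norm n)"
    then have "f z - complex_of_real t * n \<in> ball (f z) \<delta>"
      using n by (simp add: dist_norm norm_mult field_simps)
    then have img: "f z - complex_of_real t * n \<in> f ` U" using \<delta> by blast
    show "\<exists>y\<in>U. norm y < norm z \<and> f y = f z - of_real t * n"
      using inv_into_into[OF img] f_inv_into_f[OF img] d(2)[of t] t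
      by (intro bexI[of _ "\<gamma> t"]) (auto simp: \<gamma>_def norm_eq_sqrt_inner)
  qed
qed

section \<open>Global injectivity\<close>

lemma locally_injective_within:
  assumes z: "z \<in> unit_disc" and V: "open V" "z \<in> V"
  obtains U where "open U" "z \<in> U" "U \<subseteq> unit_disc" "U \<subseteq> V" "inj_on f U"
proof -
  obtain U where U: "open U" "z \<in> U" "U \<subseteq> unit_disc" "inj_on f U"
    using locally_inj z unfolding locally_univalent_def by blast
  show ?thesis
    by (rule that[of "U \<inter> V"]) (use U V in \<open>auto intro: inj_on_subset\<close>)
qed

text \<open>A boundary point cannot share its image with an interior point, since the image of a neighbourhood of
the interior point is open. If two boundary points share an image, then they share a support line of
the convex image of the open disc, and points on the common inner normal have preimages near both of
them.\<close>

lemma inj_on_cball: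
  assumes s: "0 < s" "s < 1" and inj: "inj_on f (ball 0 s)"
  shows "inj_on f (cball 0 s)"
proof -
  have sub: "cball 0 s \<subseteq> unit_disc" using s by auto
  have interior: "p = q" if p: "p \<in> ball 0 s" and q: "q \<in> cball 0 s" and eq: "f p = f q" for p q
  proof (rule ccontr)
    assume "p \<noteq> q"
    then obtain U V where UV: "open U" "open V" "p \<in> U" "q \<in> V" "U \<inter> V = {}"
      using hausdorff[of p q] by blast
    define W where "W = unit_disc \<inter> f -` (f ` (U \<inter> ball 0 s))"
    have "open (f ` (U \<inter> ball 0 s))"
    proof (rule open_image)
      show "open (U \<inter> ball 0 s)" using UV(1) by auto
      show "U \<inter> ball 0 s \<subseteq> unit_disc" using sub ball_subset_cball by blast
      show "inj_on f (U \<inter> ball 0 s)" using inj by (rule inj_on_subset) blast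
    qed
    then have "open W"
      unfolding W_def by (intro continuous_open_preimage continuous_f open_ball)
    then have "open (W \<inter> V)" using UV(2) by (rule open_Int)
    moreover have "q \<in> W"
    proof -
      have "q \<in> unit_disc" using q sub by blast
      moreover have "f p \<in> f ` (U \<inter> ball 0 s)" using UV(3) p by blast
      ultimately show ?thesis using eq by (simp add: W_def)
    qed
    then have "q \<in> closure (ball 0 s) \<inter> (W \<inter> V)" using q s UV(4) by simp
    ultimately have "(W \<inter> V) \<inter> ball 0 s \<noteq> {}"
      using open_Int_closure_eq_empty[of "W \<inter> V" "ball 0 s"] by blast
    then obtain q' where q': "q' \<in> V" "q' \<in> ball 0 s" "f q' \<in> f ` (U \<inter> ball 0 s)"
      unfolding W_def by blast
    then obtain p' where "p' \<in> U" "p' \<in> ball 0 s" "f q' = f p'" by blast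
    then show False using inj_onD[OF inj, of q' p'] q' UV by blast
  qed
  show ?thesis
  proof (rule inj_onI, rule ccontr)
    fix p q assume pq: "p \<in> cball 0 s" "q \<in> cball 0 s" "f p = f q" and ne: "p \<noteq> q"
    then have norm: "norm p = s" "norm q = s"
      using interior[of p q] interior[of q p] by force+
    have "f p \<notin> f ` ball 0 s"
      using interior[of _ p] norm by force
    then obtain n where n: "n \<noteq> 0" "\<And>z. z \<in> ball 0 s \<Longrightarrow> Re (cnj n * f z) \<le> Re (cnj n * f p)"
      using support_line[of s 0 "f p"] s by auto
    obtain U V where UV: "open U" "open V" "p \<in> U" "q \<in> V" "U \<inter> V = {}"
      using hausdorff[OF ne] by blast
    have inward: "\<exists>d>0. \<forall>t. 0 < t \<and> t < d \<longrightarrow> (\<exists>y\<in>W. norm y < s \<and> f y = f p - of_real t * n)"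
      if W: "open W" "z \<in> W" and z: "norm z = s" "f z = f p" for W z
    proof -
      have z0: "z \<noteq> 0" "z \<in> unit_disc" using z s by auto
      obtain X where X: "open X" "z \<in> X" "X \<subseteq> unit_disc" "X \<subseteq> W" "inj_on f X"
        using locally_injective_within[OF z0(2) W] .
      obtain k :: real where k: "0 < k" "z * deriv (directional n) z = k"
        using support_line_at_boundary_point[of z 0 n] n z z0 s by auto
      obtain d where "0 < d"
        "\<And>t. 0 < t \<Longrightarrow> t < d \<Longrightarrow> \<exists>y\<in>X. norm y < norm z \<and> f y = f z - of_real t * n"
        using inward_preimages[OF X(1,3,5,2) z0(1) n(1) k] by metis
      then show ?thesis using X(4) z by (metis subsetD)
    qed
    obtain d d' where d: "0 < d" "0 < d'"
      "\<And>t. 0 < t \<and> t < d \<Longrightarrow> \<exists>y\<in>U. norm y < s \<and> f y = f p - of_real t * n"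
      "\<And>t. 0 < t \<and> t < d' \<Longrightarrow> \<exists>y\<in>V. norm y < s \<and> f y = f p - of_real t * n"
      using inward[of U p] inward[of V q] UV norm pq(3) by metis
    define t where "t = min d d' / 2"
    have "0 < t" "t < d" "t < d'" using d(1,2) by (auto simp: t_def)
    then obtain y y' where "y \<in> U" "y' \<in> V" "norm y < s" "norm y' < s" "f y = f y'"
      using d(3)[of t] d(4)[of t] by auto
    then show False using inj_onD[OF inj, of y y'] UV by auto
  qed
qed

text \<open>A continuity argument on the radius of the largest concentric disc of injectivity: it cannot be less
than 1, because injectivity passes to the closed disc and from there to a larger open disc.\<close>

lemma inj_f: "inj_on f unit_disc"
proof (rule ccontr)
  assume "\<not> inj_on f unit_disc"
  then obtain p q where pq: "norm p < 1" "norm q < 1" "f p = f q" "p \<noteq> q"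
    by (auto simp: inj_on_def)
  define T where "T = {t. 0 < t \<and> inj_on f (ball 0 t)}"
  have bound: "t \<le> max (norm p) (norm q)" if "t \<in> T" for t
  proof (rule ccontr)
    assume "\<not> ?thesis"
    then have "p \<in> ball 0 t" "q \<in> ball 0 t" by auto
    then show False using that pq inj_onD[of f "ball 0 t" p q] by (auto simp: T_def)
  qed
  then have bdd: "bdd_above T" by (rule bdd_aboveI)
  obtain U where U: "open U" "0 \<in> U" "inj_on f U"
    using locally_inj unfolding locally_univalent_def by (metis centre_in_ball zero_less_one)
  then obtain e where "0 < e" "ball 0 e \<subseteq> U" by (meson openE)
  then have e: "e \<in> T" using U(3) by (auto simp: T_def intro: inj_on_subset)
  define s where "s = Sup T"
  have "e \<le> s" unfolding s_def by (rule cSup_upper[OF e bdd])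
  then have s0: "0 < s" using \<open>0 < e\<close> by simp
  have "s \<le> max (norm p) (norm q)"
    unfolding s_def using e bound by (intro cSup_least) auto
  then have s1: "s < 1" using pq by auto
  have "inj_on f (ball 0 s)"
  proof (rule inj_onI)
    fix v w assume vw: "v \<in> ball 0 s" "w \<in> ball 0 s" "f v = f w"
    then have "max (norm v) (norm w) < Sup T" by (simp add: s_def)
    then obtain t where "t \<in> T" "max (norm v) (norm w) < t"
      using less_cSup_iff[OF _ bdd] e by blast
    then show "v = w" using vw(3) by (auto simp: T_def dest: inj_onD)
  qed
  then have "inj_on f (cball 0 s)" by (rule inj_on_cball[OF s0 s1])
  moreover have sub: "cball 0 s \<subseteq> unit_disc" using s1 by auto
  moreover have "\<exists>U. open U \<and> z \<in> U \<and> inj_on f U" if "z \<in> cball 0 s" for z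
    using locally_inj that sub unfolding locally_univalent_def by (meson subsetD)
  ultimately obtain t where "s < t" "inj_on f (ball 0 t)"
    using inj_on_neighbourhood_of_cball[OF continuous_f open_ball] by blast
  then have "t \<in> T" using s0 by (simp add: T_def)
  then have "t \<le> s" unfolding s_def using bdd by (rule cSup_upper)
  then show False using \<open>s < t\<close> by simp
qed

section \<open>Curvature of the images of circles\<close>

text \<open>These multiply \<open>e\<close> and \<open>e ^ 3\<close> in \<open>circle_curvature\<close>, where \<open>e\<close> is the outer normal of a circle. The
second of them is, up to the factor \<open>(deriv h z)\<^sup>2\<close>, the derivative of the
dilatation \<open>deriv g / deriv h\<close>.\<close>

definition second_order :: "complex \<Rightarrow> complex" where
  "second_order z = cnj (deriv h z) * deriv (deriv h) z - cnj (deriv g z) * deriv (deriv g) z"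

definition wronskian :: "complex \<Rightarrow> complex" where
  "wronskian z = deriv h z * deriv (deriv g) z - deriv g z * deriv (deriv h) z"

text \<open>By injectivity, the image of the boundary point \<open>z\<close> lies outside the convex image of the open disc
with radius \<open>\<rho>\<close> and outer normal \<open>e\<close> at \<open>z\<close>, so there is a support line at \<open>f z\<close>.\<close>

lemma circle_curvature:
  assumes e: "norm e = 1" and \<rho>: "0 < \<rho>" "norm (z - of_real \<rho> * e) + \<rho> < 1"
  shows "0 \<le> jacobian z + \<rho> * Re (e * second_order z + e ^ 3 * wronskian z)"
proof -
  define \<zeta> where "\<zeta> = complex_of_real \<rho> * e"
  define c where "c = z - \<zeta>"
  have \<zeta>: "norm \<zeta> = \<rho>" "\<zeta> \<noteq> 0" using e \<rho> by (auto simp: \<zeta>_def norm_mult)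
  have z: "z = c + \<zeta>" by (simp add: c_def)
  have sub: "norm c + norm \<zeta> < 1" using \<rho>(2) \<zeta> by (simp add: c_def \<zeta>_def)
  have zD: "z \<in> unit_disc" unfolding z using norm_triangle_ineq[of c \<zeta>] sub by simp
  have ball: "ball c \<rho> \<subseteq> unit_disc"
    using sub \<zeta>(1) by (auto simp: dist_norm) (metis add.commute le_less_trans norm_minus_commute norm_triangle_sub add_le_cancel_left less_imp_le order_trans)
  have "f z \<notin> f ` ball c \<rho>"
  proof
    assume "f z \<in> f ` ball c \<rho>"
    then have "z \<in> ball c \<rho>" using inj_on_image_mem_iff[OF inj_f zD ball] by blast
    then show False using \<zeta> by (simp add: z dist_norm)
  qed
  then obtain n where n: "n \<noteq> 0" "\<And>w. w \<in> ball c \<rho> \<Longrightarrow> Re (cnj n * f w) \<le> Re (cnj n * f z)"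
    using support_line[of \<rho> c "f z"] \<rho>(1) sub \<zeta>(1) by auto
  then obtain k :: real where k: "0 < k" "\<zeta> * deriv (directional n) z = k"
    "0 \<le> Re (k + \<zeta>\<^sup>2 * deriv (deriv (directional n)) z)"
    using support_line_at_boundary_point[of \<zeta> c n] \<zeta> sub by (auto simp: z)
  have normal: "complex_of_real \<rho> * e * (cnj n * deriv h z + n * deriv g z) = k"
    using k(2) by (simp only: deriv_directional[OF zD] \<zeta>_def)
  have second: "0 \<le> Re (k + (complex_of_real \<rho> * e)\<^sup>2
      * (cnj n * deriv (deriv h) z + n * deriv (deriv g) z))"
    using k(3) by (simp only: deriv2_directional[OF zD] \<zeta>_def)
  show ?thesis
    using curvature_from_support_line[OF e \<rho>(1) k(1) _ normal second] jacobian_pos[OF zD]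
    by (simp only: jacobian_def second_order_def wronskian_def less_imp_le)
qed

text \<open>The strongest case of \<open>circle_curvature\<close>: the radius \<open>R\<close> of the largest disc inside the unit disc whose
boundary passes through \<open>z\<close> with outer normal \<open>e\<close>. Only smaller radii are available, so this is a
limit.\<close>

lemma curvature_inequality:
  assumes z: "norm z < 1" and e: "norm e = 1"
  shows "0 \<le> 2 * jacobian z
    + Re (e * ((1 - (norm z)\<^sup>2) * second_order z - 2 * cnj z * jacobian z)
        + e ^ 3 * ((1 - (norm z)\<^sup>2) * wronskian z))"
proof -
  define m where "m = 1 - Re (cnj z * e)"
  define X where "X = Re (e * second_order z + e ^ 3 * wronskian z)"
  define R where "R = (1 - (norm z)\<^sup>2) / (2 * m)"
  have "Re (cnj z * e) \<le> norm z"
    using complex_Re_le_cmod[of "cnj z * e"] e by (simp add: norm_mult)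
  then have m: "1 - norm z \<le> m" "0 < m" using z by (auto simp: m_def)
  have "1 - (norm z)\<^sup>2 = (1 + norm z) * (1 - norm z)"
    by (simp add: power2_eq_square algebra_simps)
  also have "\<dots> \<le> 2 * m" using z m by (intro mult_mono) auto
  finally have R1: "R \<le> 1" using m by (simp add: R_def)
  have R0: "0 < R" using z m by (simp add: R_def power_less_one_iff)
  have ineq: "0 \<le> jacobian z + \<rho> * X" if \<rho>: "0 < \<rho>" "\<rho> < R" for \<rho>
    unfolding X_def
  proof (rule circle_curvature[OF e \<rho>(1)])
    have "(norm (z - of_real \<rho> * e))\<^sup>2 = (norm z)\<^sup>2 - 2 * \<rho> * Re (cnj z * e) + \<rho>\<^sup>2 * (norm e)\<^sup>2"
      unfolding cmod_power2 by (simp add: power2_eq_square algebra_simps)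
    \<comment> \<open>The disc stays inside the unit disc exactly as long as \<open>\<rho>\<close> is below \<open>R\<close>.\<close>
    also have "\<dots> = (1 - \<rho>)\<^sup>2 - (2 * m) * (R - \<rho>)"
      using e m by (simp add: R_def power2_eq_square field_simps) (simp add: m_def algebra_simps)
    also have "\<dots> < (1 - \<rho>)\<^sup>2" using \<rho> m by simp
    finally have "norm (z - of_real \<rho> * e) < 1 - \<rho>"
      by (rule power_less_imp_less_base) (use \<rho> R1 in simp)
    then show "norm (z - of_real \<rho> * e) + \<rho> < 1" by simp
  qed
  have "((\<lambda>\<rho>. jacobian z + \<rho> * X) \<longlongrightarrow> jacobian z + R * X) (at_left R)"
    by (intro tendsto_intros)
  moreover have "eventually (\<lambda>\<rho>. 0 \<le> jacobian z + \<rho> * X) (at_left R)"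
    using eventually_at_left_field[of _ R] R0 ineq by (auto intro!: exI[of _ 0])
  ultimately have "0 \<le> jacobian z + R * X"
    by (rule tendsto_lowerbound) simp
  then have "0 \<le> 2 * m * (jacobian z + R * X)" using m by simp
  also have "\<dots> = 2 * jacobian z - 2 * jacobian z * Re (cnj z * e) + (1 - (norm z)\<^sup>2) * X"
    using m by (simp add: R_def distrib_left) (simp add: m_def algebra_simps)
  also have "\<dots> = 2 * jacobian z
    + Re (e * ((1 - (norm z)\<^sup>2) * second_order z - 2 * cnj z * jacobian z)
        + e ^ 3 * ((1 - (norm z)\<^sup>2) * wronskian z))"
  proof -
    have "e * ((1 - (norm z)\<^sup>2) * second_order z - 2 * cnj z * jacobian z) + e ^ 3 * ((1 - (norm z)\<^sup>2) * wronskian z)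
      = complex_of_real (1 - (norm z)\<^sup>2) * (e * second_order z + e ^ 3 * wronskian z)
        - complex_of_real (2 * jacobian z) * (cnj z * e)"
      by (simp add: algebra_simps)
    moreover have scale: "Re (complex_of_real a * w) = a * Re w" for a w by simp
    ultimately show ?thesis by (simp only: minus_complex.sel scale X_def)
  qed
  finally show ?thesis .
qed

lemma second_order_bound:
  assumes "norm z < 1"
  shows "norm ((1 - (norm z)\<^sup>2) * second_order z - 2 * cnj z * jacobian z) \<le> 4 / sqrt 3 * jacobian z"
  using cubic_exponential_coefficient_bound curvature_inequality[OF assms] by blast

text \<open>The Schwarz-Pick inequality for the dilatation \<open>deriv g / deriv h\<close>, which maps the disc to itself
because the Jacobian is positive.\<close>

lemma wronskian_bound:
  assumes z: "norm z < 1"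
  shows "(1 - (norm z)\<^sup>2) * norm (wronskian z) \<le> jacobian z"
proof -
  define \<omega> where "\<omega> = (\<lambda>z. deriv g z / deriv h z)"
  have nz: "deriv h w \<noteq> 0" if "norm w < 1" for w
    using deriv_g_less_deriv_h[of w] that by auto
  have "\<omega> holomorphic_on unit_disc"
    unfolding \<omega>_def using nz by (intro holomorphic_intros holomorphic_deriv hol_h hol_g) auto
  moreover have "norm (\<omega> w) < 1" if "norm w < 1" for w
    using deriv_g_less_deriv_h[of w] that nz[OF that] by (simp add: \<omega>_def norm_divide)
  ultimately have "norm (deriv \<omega> z) * (1 - (norm z)\<^sup>2) \<le> 1 - (norm (\<omega> z))\<^sup>2"
    using z by (rule Schwarz_Pick_derivative)
  moreover have "deriv \<omega> z = wronskian z / (deriv h z)\<^sup>2"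
    unfolding \<omega>_def using DERIV_deriv_h[of z] DERIV_deriv_g[of z] z nz[OF z]
    by (intro DERIV_imp_deriv)
      (auto intro!: derivative_eq_intros simp: wronskian_def power2_eq_square algebra_simps)
  ultimately have "norm (wronskian z) / (norm (deriv h z))\<^sup>2 * (1 - (norm z)\<^sup>2)
      \<le> 1 - (norm (deriv g z) / norm (deriv h z))\<^sup>2"
    by (simp add: \<omega>_def norm_divide norm_power)
  from mult_right_mono[OF this, of "(norm (deriv h z))\<^sup>2"]
  have "norm (wronskian z) / (norm (deriv h z))\<^sup>2 * (1 - (norm z)\<^sup>2) * (norm (deriv h z))\<^sup>2
      \<le> (1 - (norm (deriv g z) / norm (deriv h z))\<^sup>2) * (norm (deriv h z))\<^sup>2"
    by simp
  moreover have "norm (wronskian z) / (norm (deriv h z))\<^sup>2 * (1 - (norm z)\<^sup>2) * (norm (deriv h z))\<^sup>2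
      = (1 - (norm z)\<^sup>2) * norm (wronskian z)"
    using nz[OF z] by simp
  moreover have "(1 - (norm (deriv g z) / norm (deriv h z))\<^sup>2) * (norm (deriv h z))\<^sup>2 = jacobian z"
    using nz[OF z] by (simp add: jacobian_def power_divide left_diff_distrib)
  ultimately show ?thesis by (simp only:)
qed

text \<open>Solving the definitions of \<open>second_order\<close> and \<open>wronskian\<close> for the second derivatives expresses those of
\<open>h + \<epsilon> * g\<close> through two quantities that have already been estimated; the first contributes
\<open>4 / sqrt 3\<close> and the second 1. That this holds at every \<open>z\<close> and for every unimodular \<open>\<epsilon>\<close>
reflects the invariance of the class under disc automorphisms and affine maps.\<close>

lemma pre_schwarzian_bound:
  assumes z: "norm z < 1" and \<epsilon>: "norm \<epsilon> = 1"
  shows "norm ((1 - (norm z)\<^sup>2) * (deriv (deriv h) z + \<epsilon> * deriv (deriv g) z)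
      - 2 * cnj z * (deriv h z + \<epsilon> * deriv g z))
    \<le> 2 * (2 / sqrt 3 + 1 / 2) * norm (deriv h z + \<epsilon> * deriv g z)"
proof -
  define H where "H = deriv h z + \<epsilon> * deriv g z"
  define H' where "H' = deriv (deriv h) z + \<epsilon> * deriv (deriv g) z"
  define w where "w = 1 - (norm z)\<^sup>2"
  have w: "0 \<le> w" using z by (simp add: w_def power_le_one)
  have J: "0 < jacobian z" using jacobian_pos z by simp
  have Jc: "complex_of_real (jacobian z) = deriv h z * cnj (deriv h z) - deriv g z * cnj (deriv g z)"
    unfolding jacobian_def of_real_diff complex_norm_square ..
  have unit: "\<epsilon> * cnj \<epsilon> = 1" using \<epsilon> by (simp add: complex_norm_square[symmetric])
  have "\<epsilon> * cnj H = \<epsilon> * cnj (deriv h z) + (\<epsilon> * cnj \<epsilon>) * cnj (deriv g z)"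
    by (simp add: H_def algebra_simps)
  then have conj: "\<epsilon> * cnj H = \<epsilon> * cnj (deriv h z) + cnj (deriv g z)"
    by (simp add: unit)
  have key: "complex_of_real (jacobian z) * H' = H * second_order z + (\<epsilon> * cnj H) * wronskian z"
    unfolding conj unfolding Jc H_def H'_def second_order_def wronskian_def by (simp add: algebra_simps)
  have "complex_of_real (jacobian z) * (w * H' - 2 * cnj z * H)
      = w * (complex_of_real (jacobian z) * H') - jacobian z * (2 * cnj z * H)"
    by (simp add: algebra_simps)
  also have "\<dots> = H * (w * second_order z - 2 * cnj z * jacobian z) + \<epsilon> * cnj H * (w * wronskian z)"
    unfolding key by (simp add: algebra_simps)
  finally have "jacobian z * norm (w * H' - 2 * cnj z * H)
      = norm (H * (w * second_order z - 2 * cnj z * jacobian z) + \<epsilon> * cnj H * (w * wronskian z))"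
    using J by (metis abs_of_pos norm_mult norm_of_real)
  also have "\<dots> \<le> norm H * norm (w * second_order z - 2 * cnj z * jacobian z) + norm H * (w * norm (wronskian z))"
    using norm_triangle_ineq[of "H * (w * second_order z - 2 * cnj z * jacobian z)" "\<epsilon> * cnj H * (w * wronskian z)"] w
    by (simp add: norm_mult \<epsilon>)
  also have "\<dots> \<le> norm H * (4 / sqrt 3 * jacobian z) + norm H * jacobian z"
    using second_order_bound[OF z] wronskian_bound[OF z]
    by (intro add_mono mult_left_mono) (simp_all add: w_def)
  also have "\<dots> = jacobian z * (2 * (2 / sqrt 3 + 1 / 2) * norm H)"
    by (simp add: algebra_simps)
  finally show ?thesis
    using J by (simp add: H_def H'_def w_def)
qed

end

section \<open>Distortion of the derivative\<close>

text \<open>With \<open>l\<close> a logarithm of a derivative, the hypothesis confines the radial derivative of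
\<open>Re l\<close> at distance \<open>s\<close> from 0 to the interval between
\<open>(2 * s - 2 * \<alpha>) / (1 - s\<^sup>2)\<close> and \<open>(2 * s + 2 * \<alpha>) / (1 - s\<^sup>2)\<close>, and the two bounds are the integrals
of its end points.\<close>

lemma logarithmic_distortion:
  fixes l :: "complex \<Rightarrow> complex"
  assumes hol: "l holomorphic_on unit_disc"
    and bound: "\<And>z. norm z < 1 \<Longrightarrow> norm ((1 - (norm z)\<^sup>2) * deriv l z - 2 * cnj z) \<le> 2 * \<alpha>"
    and z: "norm z < 1"
  shows "Re (l z) - Re (l 0) \<le> (\<alpha> - 1) * ln (1 + norm z) - (\<alpha> + 1) * ln (1 - norm z)"
    and "(\<alpha> - 1) * ln (1 - norm z) - (\<alpha> + 1) * ln (1 + norm z) \<le> Re (l z) - Re (l 0)"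
proof -
  define e where "e = (if z = 0 then 1 else z / norm z)"
  have e: "norm e = 1" "complex_of_real (norm z) * e = z"
    by (auto simp: e_def norm_divide)
  define L where "L = (\<lambda>s. Re (l (complex_of_real s * e)))"
  define dL where "dL = (\<lambda>s. Re (e * deriv l (complex_of_real s * e)))"
  have der: "(L has_real_derivative dL s) (at s)" if "0 \<le> s" "s \<le> norm z" for s
  proof -
    have "complex_of_real s * e \<in> unit_disc" using that z e by (simp add: norm_mult)
    then have "((\<lambda>x. l (x * e)) has_field_derivative deriv l (complex_of_real s * e) * e) (at (complex_of_real s))"
      by (intro DERIV_chain2[of l] holomorphic_derivI[OF hol]) (auto intro!: derivative_eq_intros)
    from DERIV_Re_of_real[OF this] show ?thesis by (simp only: L_def dL_def mult.commute)
  qed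
  have bounds: "(1 - s\<^sup>2) * dL s \<le> 2 * s + 2 * \<alpha>" "2 * s - 2 * \<alpha> \<le> (1 - s\<^sup>2) * dL s"
    if s: "0 \<le> s" "s \<le> norm z" for s
  proof -
    have unit: "e * cnj e = 1" using e(1) by (simp add: complex_norm_square[symmetric])
    have ns: "norm (complex_of_real s * e) = s" using s e by (simp add: norm_mult)
    define w where "w = (1 - complex_of_real s ^ 2) * deriv l (complex_of_real s * e) - 2 * cnj (complex_of_real s * e)"
    have "norm w \<le> 2 * \<alpha>"
      using bound[of "complex_of_real s * e"] s z unfolding w_def ns by (simp add: ns)
    then have abs_w: "\<bar>Re (e * w)\<bar> \<le> 2 * \<alpha>"
      using abs_Re_le_cmod[of "e * w"] e by (simp add: norm_mult)
    have "e * w = complex_of_real (1 - s\<^sup>2) * (e * deriv l (complex_of_real s * e)) - complex_of_real (2 * s) * (e * cnj e)"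
      by (simp add: w_def algebra_simps)
    then have "e * w = complex_of_real (1 - s\<^sup>2) * (e * deriv l (complex_of_real s * e)) - complex_of_real (2 * s)"
      unfolding unit by simp
    moreover have scale: "Re (complex_of_real a * v) = a * Re v" for a v by simp
    ultimately have Re_w: "Re (e * w) = (1 - s\<^sup>2) * dL s - 2 * s"
      unfolding dL_def by (simp only: minus_complex.sel Re_complex_of_real scale)
    show "(1 - s\<^sup>2) * dL s \<le> 2 * s + 2 * \<alpha>" "2 * s - 2 * \<alpha> \<le> (1 - s\<^sup>2) * dL s"
      using abs_w Re_w by linarith+
  qed
  have partial_fractions: "(\<alpha> - 1) / (1 + s) + (\<alpha> + 1) / (1 - s) = (2 * s + 2 * \<alpha>) / (1 - s\<^sup>2)"
    if "\<bar>s\<bar> < 1" for s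
  proof -
    have "(\<alpha> - 1) / (1 + s) + (\<alpha> + 1) / (1 - s)
        = ((\<alpha> - 1) * (1 - s) + (\<alpha> + 1) * (1 + s)) / ((1 + s) * (1 - s))"
      using that by (intro add_frac_eq) auto
    also have "(\<alpha> - 1) * (1 - s) + (\<alpha> + 1) * (1 + s) = 2 * s + 2 * \<alpha>"
      by (simp add: algebra_simps)
    also have "(1 + s) * (1 - s) = 1 - s\<^sup>2"
      by (simp add: power2_eq_square algebra_simps)
    finally show ?thesis .
  qed
  have pos: "0 < 1 - s\<^sup>2" if "0 \<le> s" "s \<le> norm z" for s :: real
    using that z by (simp add: power_less_one_iff)
  have "((\<alpha> - 1) * ln (1 + 0) - (\<alpha> + 1) * ln (1 - 0)) - L 0
      \<le> ((\<alpha> - 1) * ln (1 + norm z) - (\<alpha> + 1) * ln (1 - norm z)) - L (norm z)"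
  proof (rule DERIV_nonneg_imp_nondecreasing
      [of 0 "norm z" "\<lambda>s. ((\<alpha> - 1) * ln (1 + s) - (\<alpha> + 1) * ln (1 - s)) - L s"])
    fix s assume s: "0 \<le> s" "s \<le> norm z"
    have "(\<alpha> - 1) / (1 + s) + (\<alpha> + 1) / (1 - s) = (2 * s + 2 * \<alpha>) / (1 - s\<^sup>2)"
      using partial_fractions[of s] s z by simp
    then have "0 \<le> (\<alpha> - 1) / (1 + s) + (\<alpha> + 1) / (1 - s) - dL s"
      using bounds(1)[OF s] pos[OF s] by (simp add: pos_le_divide_eq mult.commute)
    moreover have "((\<lambda>s. ((\<alpha> - 1) * ln (1 + s) - (\<alpha> + 1) * ln (1 - s)) - L s) has_real_derivative
        (\<alpha> - 1) / (1 + s) + (\<alpha> + 1) / (1 - s) - dL s) (at s)"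
      using s z by (auto intro!: derivative_eq_intros der)
    ultimately show "\<exists>y. ((\<lambda>s. ((\<alpha> - 1) * ln (1 + s) - (\<alpha> + 1) * ln (1 - s)) - L s) has_real_derivative y) (at s) \<and> 0 \<le> y"
      by blast
  qed simp
  then show "Re (l z) - Re (l 0) \<le> (\<alpha> - 1) * ln (1 + norm z) - (\<alpha> + 1) * ln (1 - norm z)"
    using e(2) by (simp add: L_def)
  have "L 0 - ((\<alpha> - 1) * ln (1 - 0) - (\<alpha> + 1) * ln (1 + 0))
      \<le> L (norm z) - ((\<alpha> - 1) * ln (1 - norm z) - (\<alpha> + 1) * ln (1 + norm z))"
  proof (rule DERIV_nonneg_imp_nondecreasing
      [of 0 "norm z" "\<lambda>s. L s - ((\<alpha> - 1) * ln (1 - s) - (\<alpha> + 1) * ln (1 + s))"])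
    fix s assume s: "0 \<le> s" "s \<le> norm z"
    have "(\<alpha> - 1) / (1 - s) + (\<alpha> + 1) / (1 + s) = (2 * \<alpha> - 2 * s) / (1 - s\<^sup>2)"
      using partial_fractions[of "- s"] s z by simp
    moreover have "- dL s * (1 - s\<^sup>2) \<le> 2 * \<alpha> - 2 * s"
      using bounds(2)[OF s] by (simp add: algebra_simps)
    ultimately have "- dL s \<le> (\<alpha> - 1) / (1 - s) + (\<alpha> + 1) / (1 + s)"
      using pos[OF s] by (simp only: pos_le_divide_eq)
    then have "0 \<le> dL s + (\<alpha> - 1) / (1 - s) + (\<alpha> + 1) / (1 + s)" by simp
    moreover have "((\<lambda>s. L s - ((\<alpha> - 1) * ln (1 - s) - (\<alpha> + 1) * ln (1 + s))) has_real_derivative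
        dL s + (\<alpha> - 1) / (1 - s) + (\<alpha> + 1) / (1 + s)) (at s)"
      using s z by (auto intro!: derivative_eq_intros der)
    ultimately show "\<exists>y. ((\<lambda>s. L s - ((\<alpha> - 1) * ln (1 - s) - (\<alpha> + 1) * ln (1 + s))) has_real_derivative y) (at s) \<and> 0 \<le> y"
      by blast
  qed simp
  then show "(\<alpha> - 1) * ln (1 - norm z) - (\<alpha> + 1) * ln (1 + norm z) \<le> Re (l z) - Re (l 0)"
    using e(2) by (simp add: L_def)
qed

text \<open>For \<open>\<alpha> = 2\<close> and \<open>\<bar>r\<bar> < 1\<close>, \<open>growth\<close> is the Koebe function \<open>r / (1 - r)\<^sup>2\<close>, and \<open>growth_density\<close> is its
derivative. The lower bounds are obtained from the same two functions at negative arguments: \<open>growth_density \<alpha> (- r)\<close> and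
\<open>- growth \<alpha> (- r)\<close>.\<close>

definition growth_density :: "real \<Rightarrow> real \<Rightarrow> real" where
  "growth_density \<alpha> r = (1 + r) powr (\<alpha> - 1) / (1 - r) powr (\<alpha> + 1)"

definition growth :: "real \<Rightarrow> real \<Rightarrow> real" where
  "growth \<alpha> r = (((1 + r) / (1 - r)) powr \<alpha> - 1) / (2 * \<alpha>)"

lemma growth_0 [simp]: "growth \<alpha> 0 = 0"
  by (simp add: growth_def)

lemma growth_density_pos: "\<bar>r\<bar> < 1 \<Longrightarrow> 0 < growth_density \<alpha> r"
  by (auto simp: growth_density_def)

lemma DERIV_growth:
  assumes r: "\<bar>r\<bar> < 1" and \<alpha>: "\<alpha> \<noteq> 0"
  shows "(growth \<alpha> has_real_derivative growth_density \<alpha> r) (at r)"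
proof -
  have pos: "0 < 1 + r" "0 < 1 - r" using r by auto
  have quot: "((\<lambda>r. (1 + r) / (1 - r)) has_real_derivative 2 / (1 - r)\<^sup>2) (at r)"
    using pos by (auto intro!: derivative_eq_intros simp: power2_eq_square)
  have "((\<lambda>r. ((1 + r) / (1 - r)) powr \<alpha>) has_real_derivative
      \<alpha> * ((1 + r) / (1 - r)) powr (\<alpha> - 1) * (2 / (1 - r)\<^sup>2)) (at r)"
    using DERIV_fun_powr[OF quot, of \<alpha>] pos by simp
  from DERIV_cdivide[OF DERIV_diff[OF this DERIV_const[of 1]], of "2 * \<alpha>"]
  have "(growth \<alpha> has_real_derivative
      \<alpha> * ((1 + r) / (1 - r)) powr (\<alpha> - 1) * (2 / (1 - r)\<^sup>2) / (2 * \<alpha>)) (at r)"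
    unfolding growth_def[abs_def] by simp
  moreover have "(1 - r) powr (\<alpha> + 1) = (1 - r) powr (\<alpha> - 1) * (1 - r)\<^sup>2"
  proof -
    have "(1 - r) powr (\<alpha> + 1) = (1 - r) powr ((\<alpha> - 1) + 2)" by (rule arg_cong) simp
    also have "\<dots> = (1 - r) powr (\<alpha> - 1) * (1 - r) powr 2" by (rule powr_add)
    also have "(1 - r) powr 2 = (1 - r)\<^sup>2" using pos by simp
    finally show ?thesis .
  qed
  ultimately show ?thesis
    using pos \<alpha> by (simp add: growth_density_def powr_divide)
qed

lemma derivative_distortion:
  fixes k :: "complex \<Rightarrow> complex"
  assumes hol: "k holomorphic_on unit_disc" and nz: "\<And>z. norm z < 1 \<Longrightarrow> k z \<noteq> 0" and k0: "k 0 = 1"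
    and bound: "\<And>z. norm z < 1 \<Longrightarrow> norm ((1 - (norm z)\<^sup>2) * deriv k z - 2 * cnj z * k z) \<le> 2 * \<alpha> * norm (k z)"
    and z: "norm z < 1"
  shows "norm (k z) \<le> growth_density \<alpha> (norm z)" and "growth_density \<alpha> (- norm z) \<le> norm (k z)"
proof -
  obtain l where l: "l holomorphic_on unit_disc" "\<And>z. z \<in> unit_disc \<Longrightarrow> k z = exp (l z)"
    using contractible_imp_holomorphic_log[OF hol convex_imp_contractible] nz by (metis convex_ball mem_ball_0)
  have deriv_k: "deriv k w = k w * deriv l w" if w: "w \<in> unit_disc" for w
  proof (rule DERIV_imp_deriv, rule has_field_derivative_transform_within_open[OF _ open_ball w])
    have "(l has_field_derivative deriv l w) (at w)" by (rule holomorphic_derivI[OF l(1) open_ball w])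
    then show "((\<lambda>w. exp (l w)) has_field_derivative k w * deriv l w) (at w)"
      using l(2)[OF w] by (auto intro!: derivative_eq_intros)
  qed (use l(2) in simp)
  have lbound: "norm ((1 - (norm w)\<^sup>2) * deriv l w - 2 * cnj w) \<le> 2 * \<alpha>" if w: "norm w < 1" for w
  proof -
    have "(1 - (norm w)\<^sup>2) * deriv k w - 2 * cnj w * k w = k w * ((1 - (norm w)\<^sup>2) * deriv l w - 2 * cnj w)"
      using w by (simp add: deriv_k algebra_simps)
    then have "norm (k w) * norm ((1 - (norm w)\<^sup>2) * deriv l w - 2 * cnj w) \<le> norm (k w) * (2 * \<alpha>)"
      using bound[OF w] by (simp only: norm_mult mult.commute)
    then show ?thesis using nz[OF w] by simp
  qed
  have exps: "norm (k z) = exp (Re (l z))" "Re (l 0) = 0"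
    using l(2)[of z] l(2)[of 0] z k0 norm_exp_eq_Re[of "l 0"] by simp_all
  note log = logarithmic_distortion[OF l(1) lbound z]
  have gd: "growth_density \<alpha> r = exp ((\<alpha> - 1) * ln (1 + r) - (\<alpha> + 1) * ln (1 - r))" if "\<bar>r\<bar> < 1" for r
    using that by (auto simp: growth_density_def powr_def exp_diff)
  show "norm (k z) \<le> growth_density \<alpha> (norm z)" "growth_density \<alpha> (- norm z) \<le> norm (k z)"
    using log z by (simp_all add: exps gd)
qed

context absolutely_convex_map
begin

text \<open>Half the sum of the constants \<open>4 / sqrt 3\<close> of \<open>second_order_bound\<close> and 1 of \<open>wronskian_bound\<close>. In the
terminology of linearly invariant families it bounds the order.\<close>

abbreviation "order_bound \<equiv> 2 / sqrt 3 + 1 / (2::real)"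

text \<open>The sum and the difference of the moduli of \<open>h'\<close> and \<open>g'\<close> at a point are the modulus of
\<open>h' + \<epsilon> * g'\<close> for suitable unimodular \<open>\<epsilon>\<close>, and \<open>derivative_distortion\<close> applies to these functions because
\<open>h' 0 = 1\<close> and \<open>g' 0 = 0\<close> give them the value 1 at 0.\<close>

lemma differential_distortion:
  assumes z: "norm z < 1"
  shows "norm (deriv h z) + norm (deriv g z) \<le> growth_density order_bound (norm z)"
    and "growth_density order_bound (- norm z) \<le> norm (deriv h z) - norm (deriv g z)"
proof -
  have distortion: "norm (deriv h z + \<epsilon> * deriv g z) \<le> growth_density order_bound (norm z)"
    "growth_density order_bound (- norm z) \<le> norm (deriv h z + \<epsilon> * deriv g z)" if \<epsilon>: "norm \<epsilon> = 1" for \<epsilon>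
  proof -
    define k where "k = (\<lambda>w. deriv h w + \<epsilon> * deriv g w)"
    have hol: "k holomorphic_on unit_disc"
      unfolding k_def by (intro holomorphic_intros holomorphic_deriv hol_h hol_g open_ball)
    have nz: "k w \<noteq> 0" if "norm w < 1" for w
    proof
      assume "k w = 0"
      then have "deriv h w = - (\<epsilon> * deriv g w)" by (simp add: k_def add_eq_0_iff2)
      from arg_cong[OF this, of norm] have "norm (deriv h w) = norm (deriv g w)" by (simp add: norm_mult \<epsilon>)
      then show False using deriv_g_less_deriv_h[of w] that by simp
    qed
    have k0: "k 0 = 1" by (simp add: k_def deriv_h_0 deriv_g_0)
    have dk: "deriv k w = deriv (deriv h) w + \<epsilon> * deriv (deriv g) w" if "norm w < 1" for w
      unfolding k_def using DERIV_deriv_h[of w] DERIV_deriv_g[of w] that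
      by (intro DERIV_imp_deriv) (auto intro!: derivative_eq_intros)
    have bound: "norm ((1 - (norm w)\<^sup>2) * deriv k w - 2 * cnj w * k w) \<le> 2 * order_bound * norm (k w)"
      if "norm w < 1" for w
      using pre_schwarzian_bound[OF that \<epsilon>] unfolding dk[OF that] unfolding k_def .
    show "norm (deriv h z + \<epsilon> * deriv g z) \<le> growth_density order_bound (norm z)"
      "growth_density order_bound (- norm z) \<le> norm (deriv h z + \<epsilon> * deriv g z)"
      using derivative_distortion[OF hol nz k0 bound z] by (simp_all only: k_def)
  qed
  \<comment> \<open>The unimodular factor for which \<open>\<eta> * g'\<close> is a non-negative multiple of \<open>h'\<close>.\<close>
  define \<eta> where "\<eta> = (if deriv g z = 0 then 1 else (norm (deriv g z) / norm (deriv h z)) * (deriv h z / deriv g z))"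
  have h0: "deriv h z \<noteq> 0" using deriv_g_less_deriv_h[of z] z by auto
  have \<eta>: "norm \<eta> = 1" "norm (- \<eta>) = 1"
    using h0 by (auto simp: \<eta>_def norm_mult norm_divide)
  have aligned: "\<eta> * deriv g z = complex_of_real (norm (deriv g z) / norm (deriv h z)) * deriv h z"
    by (simp add: \<eta>_def)
  have "deriv h z + \<eta> * deriv g z = complex_of_real (1 + norm (deriv g z) / norm (deriv h z)) * deriv h z"
    "deriv h z + - \<eta> * deriv g z = complex_of_real (1 - norm (deriv g z) / norm (deriv h z)) * deriv h z"
    using aligned by (simp_all add: algebra_simps)
  then have "norm (deriv h z + \<eta> * deriv g z) = \<bar>1 + norm (deriv g z) / norm (deriv h z)\<bar> * norm (deriv h z)"
    "norm (deriv h z + - \<eta> * deriv g z) = \<bar>1 - norm (deriv g z) / norm (deriv h z)\<bar> * norm (deriv h z)"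
    by (simp_all only: norm_mult norm_of_real)
  moreover have "norm (deriv g z) / norm (deriv h z) \<le> 1"
    using deriv_g_less_deriv_h[of z] z by (simp add: divide_le_eq_1)
  ultimately have "norm (deriv h z + \<eta> * deriv g z) = norm (deriv h z) + norm (deriv g z)"
    "norm (deriv h z + - \<eta> * deriv g z) = norm (deriv h z) - norm (deriv g z)"
    using h0 by (simp_all add: algebra_simps)
  then show "norm (deriv h z) + norm (deriv g z) \<le> growth_density order_bound (norm z)"
    "growth_density order_bound (- norm z) \<le> norm (deriv h z) - norm (deriv g z)"
    using distortion(1)[OF \<eta>(1)] distortion(2)[OF \<eta>(2)] by simp_all
qed

section \<open>Growth and covering\<close>

lemma order_bound_pos: "0 < order_bound"
  by (intro add_pos_pos) simp_all

text \<open>Integration of the upper bound for the differential along the radius, applied to the component of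
\<open>f\<close> in the direction of \<open>f z\<close>.\<close>

lemma norm_f_le_growth:
  assumes z: "norm z < 1"
  shows "norm (f z) \<le> growth order_bound (norm z)"
proof -
  define e where "e = (if z = 0 then 1 else z / norm z)"
  have e: "norm e = 1" "complex_of_real (norm z) * e = z"
    by (auto simp: e_def norm_divide)
  define u where "u = (if f z = 0 then 1 else f z / norm (f z))"
  have "norm u = 1" by (simp add: u_def norm_divide)
  have "cnj u * f z = norm (f z)"
    by (simp add: u_def complex_norm_square power2_eq_square field_simps flip: of_real_mult)
       (simp add: complex_norm_square flip: of_real_power power2_eq_square)
  then have top: "Re (directional u z) = norm (f z)"
    using z by (simp only: Re_directional mem_ball_0 Re_complex_of_real)
  have bottom: "Re (directional u 0) = 0"
    using f_0 by (simp add: Re_directional)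
  define \<phi> where "\<phi> = (\<lambda>s. Re (directional u (complex_of_real s * e)))"
  have "growth order_bound 0 - \<phi> 0 \<le> growth order_bound (norm z) - \<phi> (norm z)"
  proof (rule DERIV_nonneg_imp_nondecreasing[of 0 "norm z" "\<lambda>s. growth order_bound s - \<phi> s"])
    fix s assume s: "0 \<le> s" "s \<le> norm z"
    let ?w = "complex_of_real s * e"
    have w: "norm ?w = s" using s e by (simp add: norm_mult)
    then have wD: "?w \<in> unit_disc" using s z by simp
    have "((\<lambda>x. directional u (x * e)) has_field_derivative deriv (directional u) ?w * e) (at (complex_of_real s))"
      by (intro DERIV_chain2[of "directional u"] holomorphic_derivI[OF holomorphic_directional open_ball wD])
        (auto intro!: derivative_eq_intros)
    from DERIV_Re_of_real[OF this]
    have "(\<phi> has_real_derivative Re (deriv (directional u) ?w * e)) (at s)"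
      by (simp only: \<phi>_def)
    moreover have "(growth order_bound has_real_derivative growth_density order_bound s) (at s)"
      using s z by (intro DERIV_growth) (use order_bound_pos in auto)
    moreover have "Re (deriv (directional u) ?w * e) \<le> growth_density order_bound s"
    proof -
      have "Re (deriv (directional u) ?w * e) \<le> norm (deriv (directional u) ?w)"
        using complex_Re_le_cmod[of "deriv (directional u) ?w * e"] e by (simp add: norm_mult)
      also have "\<dots> \<le> norm (deriv h ?w) + norm (deriv g ?w)"
        using norm_triangle_ineq[of "cnj u * deriv h ?w" "u * deriv g ?w"] \<open>norm u = 1\<close>
        by (simp add: deriv_directional[OF wD] norm_mult)
      also have "\<dots> \<le> growth_density order_bound s"
        using differential_distortion(1)[of ?w] wD w by simp
      finally show ?thesis .
    qed
    ultimately show "\<exists>y. ((\<lambda>s. growth order_bound s - \<phi> s) has_real_derivative y) (at s) \<and> 0 \<le> y"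
      by (intro exI[of _ "growth_density order_bound s - Re (deriv (directional u) ?w * e)"] conjI DERIV_diff) simp_all
  qed simp
  then show ?thesis using top bottom e by (simp add: \<phi>_def)
qed

text \<open>The Jacobian is the product of the greatest and the least stretching \<open>\<bar>h'\<bar> + \<bar>g'\<bar>\<close> and
\<open>\<bar>h'\<bar> - \<bar>g'\<bar>\<close> of the differential.\<close>

lemma norm_inverse_differential:
  assumes z: "z \<in> unit_disc"
  shows "norm (inverse_differential z w) \<le> norm w / (norm (deriv h z) - norm (deriv g z))"
proof -
  let ?a = "norm (deriv h z)" and ?b = "norm (deriv g z)"
  have less: "?b < ?a" using deriv_g_less_deriv_h[OF z] .
  have J: "jacobian z = (?a + ?b) * (?a - ?b)"
    by (simp add: jacobian_def power2_eq_square algebra_simps)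
  have "norm (cnj (deriv h z) * w - cnj (deriv g z) * cnj w) \<le> (?a + ?b) * norm w"
    using norm_triangle_ineq4[of "cnj (deriv h z) * w" "cnj (deriv g z) * cnj w"]
    by (simp add: norm_mult distrib_right)
  then have "norm (inverse_differential z w) \<le> (?a + ?b) * norm w / jacobian z"
    using jacobian_pos[OF z] by (simp add: inverse_differential_def norm_divide divide_right_mono)
  also have "\<dots> = norm w / (?a - ?b)"
  proof -
    have "0 < ?a + ?b" using less norm_ge_zero[of "deriv g z"] by linarith
    then show ?thesis unfolding J by simp
  qed
  finally show ?thesis .
qed

text \<open>The image of a concentric disc is convex and contains 0, so the segment from 0 to \<open>f z\<close> lifts to a path
\<open>\<gamma>\<close> from 0 to \<open>z\<close>. Its speed is at most \<open>norm (f z)\<close> divided by the least stretching of the differential,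
which is at least the derivative of the lower bound at \<open>norm \<gamma>\<close>; hence the lower bound grows along
\<open>\<gamma>\<close> by at most \<open>norm (f z)\<close>.\<close>

lemma growth_le_norm_f:
  assumes z: "norm z < 1" "z \<noteq> 0"
  shows "- growth order_bound (- norm z) \<le> norm (f z)"
proof -
  \<comment> \<open>Any radius strictly between \<open>norm z\<close> and 1 puts \<open>f z\<close> itself into the convex image.\<close>
  define r where "r = (1 + norm z) / 2"
  have r: "norm z < r" "r < 1" "0 < r" using z by (auto simp: r_def add_pos_nonneg)
  have segment: "t *\<^sub>R f z \<in> f ` unit_disc" if t: "0 \<le> t" "t \<le> 1" for t
  proof -
    have "f z \<in> f ` ball 0 r" "f 0 \<in> f ` ball 0 r"
      using r by auto
    then have "(1 - t) *\<^sub>R f 0 + t *\<^sub>R f z \<in> f ` ball 0 r"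
      by (intro convexD[OF convex_image]) (use r t in auto)
    then have "t *\<^sub>R f z \<in> f ` ball 0 r"
      by (simp add: f_0)
    then show ?thesis using r by auto
  qed
  let ?G = "inv_into unit_disc f"
  define \<gamma> where "\<gamma> = (\<lambda>t::real. ?G (t *\<^sub>R f z))"
  have \<gamma>_D: "\<gamma> t \<in> unit_disc" and f_\<gamma>: "f (\<gamma> t) = t *\<^sub>R f z" if "0 \<le> t" "t \<le> 1" for t
    using inv_into_into[OF segment[OF that]] f_inv_into_f[OF segment[OF that]] by (simp_all add: \<gamma>_def)
  have ends: "\<gamma> 0 = 0" "\<gamma> 1 = z"
    using inj_onD[OF inj_f _ \<gamma>_D[of 0], of 0] inj_onD[OF inj_f _ \<gamma>_D[of 1], of z] f_\<gamma>[of 0] f_\<gamma>[of 1] f_0 z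
    by auto
  have nonzero: "\<gamma> t \<noteq> 0" if "0 < t" "t \<le> 1" for t
  proof
    assume "\<gamma> t = 0"
    then have "f z = 0" using f_\<gamma>[of t] that f_0 by simp
    then show False using inj_onD[OF inj_f, of z 0] f_0 z by simp
  qed
  have der: "(\<gamma> has_derivative (\<lambda>s. inverse_differential (\<gamma> t) (s *\<^sub>R f z))) (at t)"
    if t: "0 \<le> t" "t \<le> 1" for t
    unfolding \<gamma>_def
  proof (rule has_derivative_compose[where g = ?G and f = "\<lambda>t. t *\<^sub>R f z"
        and f' = "\<lambda>s. s *\<^sub>R f z" and g' = "inverse_differential (?G (t *\<^sub>R f z))"])
    show "((\<lambda>t. t *\<^sub>R f z) has_derivative (\<lambda>s. s *\<^sub>R f z)) (at t)"
      by (auto intro!: derivative_eq_intros)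
    show "(?G has_derivative inverse_differential (?G (t *\<^sub>R f z))) (at (t *\<^sub>R f z))"
      using has_derivative_local_inverse[OF open_ball order_refl inj_f \<gamma>_D[OF t]] f_\<gamma>[OF t]
      by (simp add: \<gamma>_def)
  qed
  define \<phi> where "\<phi> = (\<lambda>t. - growth order_bound (- norm (\<gamma> t)))"
  define \<phi>' where "\<phi>' = (\<lambda>t s. growth_density order_bound (- norm (\<gamma> t))
      * (inverse_differential (\<gamma> t) (s *\<^sub>R f z) \<bullet> sgn (\<gamma> t)))"
  have DERIV_lower: "((\<lambda>x. - growth order_bound (- x)) has_real_derivative growth_density order_bound (- x)) (at x)"
    if "\<bar>x\<bar> < 1" for x
  proof -
    have "(growth order_bound has_real_derivative growth_density order_bound (- x)) (at (- x))"
      using that by (intro DERIV_growth) (use order_bound_pos in auto)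
    from DERIV_minus[OF DERIV_chain2[OF this DERIV_minus[OF DERIV_ident]]] show ?thesis by simp
  qed
  \<comment> \<open>The norm is not differentiable at \<open>\<gamma> 0 = 0\<close>; the mean value theorem asks for derivatives at interior
    points only, where \<open>\<gamma>\<close> does not vanish.\<close>
  have "\<exists>\<xi>. 0 < \<xi> \<and> \<xi> < 1 \<and> \<phi> 1 - \<phi> 0 = \<phi>' \<xi> (1 - 0)"
  proof (rule mvt[of 0 1 \<phi> \<phi>'])
    have cont_\<gamma>: "continuous_on {0..1} \<gamma>"
      by (intro continuous_at_imp_continuous_on ballI has_derivative_continuous[OF der]) auto
    have cont_lower: "continuous_on {-1<..<1} (\<lambda>x. - growth order_bound (- x))"
      by (intro continuous_at_imp_continuous_on ballI DERIV_isCont[OF DERIV_lower]) auto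
    have "norm (\<gamma> t) \<in> {-1<..<1}" if "t \<in> {0..1}" for t
      using \<gamma>_D[of t] that less_le_trans[of "-1" 0 "norm (\<gamma> t)"] by simp
    then show "continuous_on {0..1} \<phi>"
      unfolding \<phi>_def
      by (intro continuous_on_compose2[OF cont_lower continuous_on_norm[OF cont_\<gamma>]]) blast
    fix t :: real assume t: "0 < t" "t < 1"
    have "((\<lambda>t. norm (\<gamma> t)) has_derivative (\<lambda>s. inverse_differential (\<gamma> t) (s *\<^sub>R f z) \<bullet> sgn (\<gamma> t))) (at t)"
      by (rule has_derivative_compose[OF der has_derivative_norm[OF nonzero]]) (use t in auto)
    moreover have "((\<lambda>x. - growth order_bound (- x)) has_derivative (\<lambda>y. growth_density order_bound (- norm (\<gamma> t)) * y)) (at (norm (\<gamma> t)))"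
      using DERIV_lower[of "norm (\<gamma> t)"] \<gamma>_D[of t] t by (simp add: has_field_derivative_def)
    ultimately show "(\<phi> has_derivative \<phi>' t) (at t)"
      unfolding \<phi>_def \<phi>'_def by (rule has_derivative_compose)
  qed auto
  then obtain t where t: "0 < t" "t < 1" "\<phi> 1 - \<phi> 0 = \<phi>' t 1" by auto
  have D: "\<gamma> t \<in> unit_disc" using \<gamma>_D t by simp
  define q where "q = norm (deriv h (\<gamma> t)) - norm (deriv g (\<gamma> t))"
  have q: "0 < q" "growth_density order_bound (- norm (\<gamma> t)) \<le> q"
    using deriv_g_less_deriv_h[OF D] differential_distortion(2)[of "\<gamma> t"] D by (auto simp: q_def)
  have "inverse_differential (\<gamma> t) (f z) \<bullet> sgn (\<gamma> t) \<le> norm (inverse_differential (\<gamma> t) (f z))"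
    using norm_cauchy_schwarz[of "inverse_differential (\<gamma> t) (f z)" "sgn (\<gamma> t)"] nonzero[of t] t
    by (simp add: norm_sgn)
  also have "\<dots> \<le> norm (f z) / q"
    unfolding q_def by (rule norm_inverse_differential[OF D])
  finally have "inverse_differential (\<gamma> t) (f z) \<bullet> sgn (\<gamma> t) \<le> norm (f z) / q" .
  moreover have "0 \<le> growth_density order_bound (- norm (\<gamma> t))"
    using growth_density_pos[of "- norm (\<gamma> t)" order_bound] D by simp
  ultimately have "\<phi>' t 1 \<le> growth_density order_bound (- norm (\<gamma> t)) * (norm (f z) / q)"
    unfolding \<phi>'_def scaleR_one by (rule mult_left_mono)
  also have "\<dots> \<le> q * (norm (f z) / q)"
    using q by (intro mult_right_mono) simp_all
  also have "\<dots> = norm (f z)" using q by simp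
  finally show ?thesis using t(3) by (simp add: \<phi>_def ends)
qed

text \<open>The image of a disc of radius \<open>r\<close> is open and has its frontier in the image of the circle, where the
modulus is at least \<open>- growth order_bound (- r)\<close>; so it contains the disc with this radius. These radii tend
to the stated one as \<open>r\<close> tends to 1.\<close>

lemma covers_disc: "ball 0 (1 / (2 * order_bound)) \<subseteq> f ` unit_disc"
proof
  fix w :: complex assume w: "w \<in> ball 0 (1 / (2 * order_bound))"
  define m where "m = (\<lambda>r. - growth order_bound (- r))"
  note op = order_bound_pos
  have m_eq: "m r = (1 - ((1 - r) / (1 + r)) powr order_bound) / (2 * order_bound)" for r
    by (simp add: m_def growth_def minus_divide_left)
  have "((\<lambda>r. ((1 - r) / (1 + r)) powr order_bound) \<longlongrightarrow> ((1 - 1) / (1 + 1)) powr order_bound) (at_left 1)"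
  proof (rule tendsto_powr')
    show "((\<lambda>r. (1 - r) / (1 + r)) \<longlongrightarrow> (1 - 1) / (1 + 1::real)) (at_left 1)"
      by (intro tendsto_intros) simp
    have "\<forall>\<^sub>F r in at_left (1::real). 0 \<le> (1 - r) / (1 + r)"
      using eventually_at_left_field[of _ "1::real"] by (auto intro!: exI[of _ 0])
    then show "(1 - 1) / (1 + 1) \<noteq> (0::real) \<or> 0 < order_bound \<and> (\<forall>\<^sub>F r in at_left (1::real). 0 \<le> (1 - r) / (1 + r))"
      using op by simp
  qed (rule tendsto_const)
  then have "(m \<longlongrightarrow> (1 - 0) / (2 * order_bound)) (at_left 1)"
    unfolding m_eq[abs_def] using op by (intro tendsto_intros) simp_all
  then have "\<forall>\<^sub>F r in at_left 1. norm w < m r"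
    using w by (intro order_tendstoD(1)) simp_all
  moreover have "\<forall>\<^sub>F r in at_left (1::real). 0 < r"
    using eventually_at_left_field[of _ "1::real"] by (auto intro!: exI[of _ 0])
  moreover have "\<forall>\<^sub>F r in at_left (1::real). r < 1"
    by (simp add: eventually_at_filter)
  ultimately have "\<forall>\<^sub>F r in at_left 1. norm w < m r \<and> 0 < r \<and> r < 1"
    by eventually_elim simp
  then obtain r where r: "norm w < m r" "0 < r" "r < 1"
    using eventually_happens[of _ "at_left (1::real)"] by auto
  have sub: "cball 0 r \<subseteq> unit_disc" "ball 0 r \<subseteq> unit_disc" using r by auto
  show "w \<in> f ` unit_disc"
  proof (rule ccontr)
    assume "w \<notin> f ` unit_disc"
    then have "w \<notin> f ` ball 0 r" using sub by blast
    then have "ball 0 (m r) - f ` ball 0 r \<noteq> {}" using r by auto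
    moreover have "0 \<in> ball 0 (m r) \<inter> f ` ball 0 r"
      using r f_0 le_less_trans[OF norm_ge_zero r(1)] by (auto intro: image_eqI[of _ _ 0])
    ultimately obtain y where y: "y \<in> ball 0 (m r)" "y \<in> frontier (f ` ball 0 r)"
      using connected_Int_frontier[of "ball 0 (m r)" "f ` ball 0 r", OF connected_ball] by blast
    have "open (f ` ball 0 r)"
      using sub(2) inj_f by (intro open_image) (auto intro: inj_on_subset)
    then have not_in: "y \<notin> f ` ball 0 r"
      using y(2) by (simp add: frontier_def interior_open)
    have "compact (f ` cball 0 r)"
      using continuous_on_subset[OF continuous_f sub(1)] by (intro compact_continuous_image compact_cball)
    then have "closure (f ` ball 0 r) \<subseteq> f ` cball 0 r"
      by (intro closure_minimal compact_imp_closed) auto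
    then obtain v where v: "v \<in> cball 0 r" "y = f v"
      using y(2) by (auto simp: frontier_def)
    then have "norm v = r" using not_in by (auto simp: le_less)
    then have "m r \<le> norm y"
      using growth_le_norm_f[of v] v r by (auto simp: m_def)
    then show False using y(1) by simp
  qed
qed

lemma second_coefficient_bound: "norm (deriv (deriv h) 0) \<le> 4 / sqrt 3"
  using second_order_bound[of 0] by (simp add: second_order_def jacobian_def deriv_h_0 deriv_g_0)

end

section \<open>Power series normalisation\<close>

lemma harmonic_repr_derivatives:
  assumes "harmonic_repr f h g a b"
  shows "h 0 = 0" "g 0 = 0" "deriv h 0 = 1" "deriv (deriv h) 0 = 2 * a 2"
proof -
  have series_h: "\<And>z. z \<in> unit_disc \<Longrightarrow> (\<lambda>n. a (n + 2) * z ^ (n + 2)) sums (h z - z)"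
    and series_g: "\<And>z. z \<in> unit_disc \<Longrightarrow> (\<lambda>n. b (n + 1) * z ^ (n + 1)) sums g z"
    using assms unfolding harmonic_repr_def by blast+
  show "g 0 = 0" using series_g[of 0] sums_unique2[OF _ sums_zero] by force
  define F where "F = Abs_fps (\<lambda>n. if n = 0 then 0 else if n = 1 then 1 else a n)"
  have "(\<lambda>n. fps_nth F n * z ^ n) sums h z" if "z \<in> unit_disc" for z
  proof -
    have "(\<lambda>n. fps_nth F (n + 2) * z ^ (n + 2)) sums (h z - (\<Sum>i<2. fps_nth F i * z ^ i))"
      using series_h[OF that] by (simp add: F_def numeral_2_eq_2)
    then show ?thesis by (subst (asm) sums_iff_shift) simp
  qed
  then have "\<forall>\<^sub>F z in nhds 0. (\<lambda>n. fps_nth F n * z ^ n) sums h z"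
    by (auto intro!: eventually_nhds_in_open[THEN eventually_mono, of unit_disc])
  then have "h has_fps_expansion F" by (rule has_fps_expansionI)
  note coeff = fps_nth_fps_expansion[OF this]
  show "h 0 = 0" using coeff[of 0] by (simp add: F_def)
  show "deriv h 0 = 1" using coeff[of 1] by (simp add: F_def)
  show "deriv (deriv h) 0 = 2 * a 2" using coeff[of 2] by (simp add: F_def numeral_2_eq_2 mult.commute)
qed

text \<open>Since \<open>deriv h 0 = 1\<close> for every decomposition, this determines \<open>deriv g 0\<close> from \<open>f\<close> alone, so that the
normalisation \<open>deriv g 0 = 0\<close> of one decomposition carries over to all others.\<close>

lemma has_derivative_harmonic_repr:
  assumes "harmonic_repr f h g a b"
  shows "(f has_derivative (\<lambda>u. u + cnj (deriv g 0 * u))) (at 0)"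
proof -
  have hol: "h holomorphic_on unit_disc" "g holomorphic_on unit_disc"
    and eq: "\<And>z. z \<in> unit_disc \<Longrightarrow> f z = h z + cnj (g z)"
    using assms by (auto simp: harmonic_repr_def analytic_imp_holomorphic)
  have "(h has_field_derivative 1) (at 0)" "(g has_field_derivative deriv g 0) (at 0)"
    using holomorphic_derivI[OF hol(1), of 0] holomorphic_derivI[OF hol(2), of 0]
      harmonic_repr_derivatives(3)[OF assms] by auto
  then have "((\<lambda>w. h w + cnj (g w)) has_derivative (\<lambda>u. 1 * u + cnj (deriv g 0 * u))) (at 0)"
    unfolding has_field_derivative_def by (intro has_derivative_add has_derivative_cnj)
  then have "((\<lambda>w. h w + cnj (g w)) has_derivative (\<lambda>u. u + cnj (deriv g 0 * u))) (at 0)"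
    by simp
  then show ?thesis
    by (rule has_derivative_transform_within_open[OF _ open_ball[of 0 1]]) (use eq in auto)
qed

lemma class_AK0_absolutely_convex_map:
  assumes f: "f \<in> class_AK0" and repr: "harmonic_repr f h g a b"
  shows "absolutely_convex_map f h g"
proof
  show "h holomorphic_on unit_disc" "g holomorphic_on unit_disc"
    using repr by (auto simp: harmonic_repr_def analytic_imp_holomorphic)
  show "f z = h z + cnj (g z)" if "z \<in> unit_disc" for z
    using repr that by (auto simp: harmonic_repr_def)
  show "locally_univalent f" using f by (simp add: class_AK0_def class_AK_def)
  show "convex (f ` ball c r)" if "0 < r" "norm c + r < 1" for c r
  proof -
    have "norm c < 1" "r < 1 - norm c" using that by auto
    moreover have "sub_disc c r = ball c r"
    proof -
      have "norm z < 1" if "norm (z - c) < r" for z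
        using norm_triangle_sub[of z c] that \<open>r < 1 - norm c\<close> by linarith
      then show ?thesis by (auto simp: sub_disc_def dist_norm norm_minus_commute)
    qed
    moreover have "\<forall>c\<in>unit_disc. \<forall>r. 0 < r \<and> r < 1 - norm c \<longrightarrow> convex (f ` sub_disc c r)"
      using f by (simp add: class_AK0_def class_AK_def)
    ultimately show ?thesis
      using \<open>0 < r\<close> by (metis mem_ball_0)
  qed
  show "f 0 = 0" "deriv h 0 = 1"
    using harmonic_repr_derivatives[OF repr] repr by (auto simp: harmonic_repr_def)
  obtain h' g' a' b' where repr': "harmonic_repr f h' g' a' b'" and "deriv g' 0 = 0"
    using f by (auto simp: class_AK0_def)
  have "(\<lambda>u. u + cnj (deriv g 0 * u)) = (\<lambda>u. u + cnj (deriv g' 0 * u))"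
    using has_derivative_unique[OF has_derivative_harmonic_repr[OF repr] has_derivative_harmonic_repr[OF repr']] .
  from fun_cong[OF this, of 1] show "deriv g 0 = 0"
    using \<open>deriv g' 0 = 0\<close> by simp
qed

theorem theorem2:
  fixes f :: "complex \<Rightarrow> complex"
  assumes "f \<in> class_AK0"
  shows "(\<forall>h g a b. harmonic_repr f h g a b \<longrightarrow> norm (a 2) \<le> 2 / sqrt 3)
    \<and> (\<forall>z r. 0 < norm z \<and> norm z = r \<and> r < 1 \<longrightarrow>
          (sqrt 3 / (sqrt 3 + 4)) * (1 - ((1 - r) / (1 + r)) powr ((sqrt 3 + 4) / (2 * sqrt 3)))
            \<le> norm (f z)
        \<and> norm (f z)
            \<le> (sqrt 3 / (sqrt 3 + 4)) * (((1 + r) / (1 - r)) powr ((sqrt 3 + 4) / (2 * sqrt 3)) - 1))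
    \<and> {w. norm w < sqrt 3 / (sqrt 3 + 4)} \<subseteq> f ` unit_disc"
proof -
  obtain h g a b where repr: "harmonic_repr f h g a b"
    using assms by (auto simp: class_AK0_def)
  interpret absolutely_convex_map f h g
    by (rule class_AK0_absolutely_convex_map[OF assms repr])
  have order: "order_bound = (sqrt 3 + 4) / (2 * sqrt 3)"
    by (simp add: field_simps)
  have "0 < sqrt 3 + 4" by (simp add: add_pos_pos)
  then have radius: "1 / (2 * order_bound) = sqrt 3 / (sqrt 3 + 4)"
    unfolding order by (simp add: field_simps)
  have growth: "growth order_bound r
      = sqrt 3 / (sqrt 3 + 4) * (((1 + r) / (1 - r)) powr ((sqrt 3 + 4) / (2 * sqrt 3)) - 1)" for r
    unfolding growth_def radius[symmetric] unfolding order by simp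
  have "norm (a 2) \<le> 2 / sqrt 3" if "harmonic_repr f h g a b" for h g a b
  proof -
    interpret repr: absolutely_convex_map f h g
      by (rule class_AK0_absolutely_convex_map[OF assms that])
    show ?thesis
      using repr.second_coefficient_bound harmonic_repr_derivatives(4)[OF that] by (simp add: norm_mult)
  qed
  moreover have "(sqrt 3 / (sqrt 3 + 4)) * (1 - ((1 - r) / (1 + r)) powr ((sqrt 3 + 4) / (2 * sqrt 3))) \<le> norm (f z)"
    if "0 < norm z" "norm z = r" "r < 1" for z r
  proof -
    have "- growth order_bound (- r)
        = (sqrt 3 / (sqrt 3 + 4)) * (1 - ((1 - r) / (1 + r)) powr ((sqrt 3 + 4) / (2 * sqrt 3)))"
      unfolding growth mult_minus_right[symmetric] by simp
    then show ?thesis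
      using growth_le_norm_f[of z] that by force
  qed
  moreover have "norm (f z) \<le> (sqrt 3 / (sqrt 3 + 4)) * (((1 + r) / (1 - r)) powr ((sqrt 3 + 4) / (2 * sqrt 3)) - 1)"
    if "norm z = r" "r < 1" for z r
    using norm_f_le_growth[of z] that growth[of r] by simp
  moreover have "{w. norm w < sqrt 3 / (sqrt 3 + 4)} \<subseteq> f ` unit_disc"
    using covers_disc unfolding radius by auto
  ultimately show ?thesis by blast
qed

end
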